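(* Let $\mathcal{X}$ be a Hilbert space and let $k(x,y)=\widehat{\mu}(x-y)$, $x,y\in\mathcal{X}$, be a kernel on $\mathcal{X}$, where $\mu$ is some Borel probability measure on $\mathcal{X}$. If $\mu$ has full support, then $k$ is characteristic.
   Context: The Fourier transform of a Borel probability measure $\mu$ on a (real) Hilbert space $\mathcal{X}$ is $\widehat{\mu}(x)=\int_{\mathcal{X}}e^{i\langle x,v\rangle_{\mathcal{X}}}\,d\mu(v)$. Full support means that every nonempty open subset of $\mathcal{X}$ has positive $\mu$-measure. A kernel on a set $\mathcal{X}$ is a symmetric function $k\colon\mathcal{X}\times\mathcal{X}\to\mathbb{R}$ (real-valued) that is positive definite, i.e. $\sum_{i,j=1}^{n}a_ia_jk(x_i,x_j)\ge 0$ for all $n$, $a_i\in\mathbb{R}$, $x_i\in\mathcal{X}$; $\mathcal{H}_k$, with norm $\|\cdot\|_k$, denotes its reproducing kernel Hilbert space. For a bounded measurable kernel $k$ and a Borel probability measure $P$ on $\mathcal{X}$, the kernel mean embedding is $\Phi_kP=\int_{\mathcal{X}}k(\cdot,y)\,dP(y)\in\mathcal{H}_k$ (Bochner integral), and the maximum mean discrepancy of $P$ and $Q$ is $\mathrm{MMD}_k(P,Q)=\|\Phi_kP-\Phi_kQ\|_k$. The kernel $k$ is characteristic if, for all Borel probability measures $P,Q$ on $\mathcal{X}$, $\mathrm{MMD}_k(P,Q)=0$ implies $P=Q$ (equivalently, $P\mapsto\Phi_kP$ is injective). *)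

theory Defs
  imports "HOL-Probability.Probability"
begin

definition borel_prob :: "'a::topological_space measure \<Rightarrow> bool" where
  "borel_prob P \<longleftrightarrow> prob_space P \<and> sets P = sets borel"

definition full_support :: "'a::topological_space measure \<Rightarrow> bool" where
  "full_support \<mu> \<longleftrightarrow> (\<forall>U. open U \<and> U \<noteq> {} \<longrightarrow> 0 < emeasure \<mu> U)"

definition fourier :: "'a::real_inner measure \<Rightarrow> 'a \<Rightarrow> complex" where
  "fourier \<mu> x = (\<integral>v. exp (\<i> * complex_of_real (x \<bullet> v)) \<partial>\<mu>)"

definition is_kernel :: "('a \<Rightarrow> 'a \<Rightarrow> real) \<Rightarrow> bool" where
  "is_kernel k \<longleftrightarrow>
     (\<forall>x y. k x y = k y x) \<and>
     (\<forall>n::nat. \<forall>a :: nat \<Rightarrow> real. \<forall>x :: nat \<Rightarrow> 'a.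
        0 \<le> (\<Sum>i<n. \<Sum>j<n. a i * a j * k (x i) (x j)))"


text \<open>
  The reproducing kernel Hilbert space depends on the kernel, so it cannot be a type with a
  type-class norm.  It is represented by a set \<open>H\<close> of real functions (with pointwise operations)
  and an inner product \<open>ip\<close> on \<open>H\<close>.  By convention \<open>ip\<close> vanishes unless both arguments lie in
  \<open>H\<close>, which makes the induced distance satisfy \<^locale>\<open>Metric_space\<close>.
\<close>

definition inner_on :: "('a \<Rightarrow> real) set \<Rightarrow> (('a \<Rightarrow> real) \<Rightarrow> ('a \<Rightarrow> real) \<Rightarrow> real) \<Rightarrow> bool" where
  "inner_on H ip \<longleftrightarrow>
     (\<lambda>x. 0) \<in> H \<and>
     (\<forall>f\<in>H. \<forall>g\<in>H. (\<lambda>x. f x + g x) \<in> H) \<and>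
     (\<forall>c. \<forall>f\<in>H. (\<lambda>x. c * f x) \<in> H) \<and>
     (\<forall>f g. f \<notin> H \<or> g \<notin> H \<longrightarrow> ip f g = 0) \<and>
     (\<forall>f\<in>H. \<forall>g\<in>H. ip f g = ip g f) \<and>
     (\<forall>f\<in>H. \<forall>g\<in>H. \<forall>h\<in>H. ip (\<lambda>x. f x + g x) h = ip f h + ip g h) \<and>
     (\<forall>c. \<forall>f\<in>H. \<forall>g\<in>H. ip (\<lambda>x. c * f x) g = c * ip f g) \<and>
     (\<forall>f\<in>H. 0 \<le> ip f f) \<and>
     (\<forall>f\<in>H. ip f f = 0 \<longrightarrow> f = (\<lambda>x. 0))"

definition ip_norm :: "(('a \<Rightarrow> real) \<Rightarrow> ('a \<Rightarrow> real) \<Rightarrow> real) \<Rightarrow> ('a \<Rightarrow> real) \<Rightarrow> real" where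
  "ip_norm ip f = sqrt (ip f f)"

definition ip_dist ::
  "(('a \<Rightarrow> real) \<Rightarrow> ('a \<Rightarrow> real) \<Rightarrow> real) \<Rightarrow> ('a \<Rightarrow> real) \<Rightarrow> ('a \<Rightarrow> real) \<Rightarrow> real" where
  "ip_dist ip f g = ip_norm ip (\<lambda>x. f x - g x)"

definition is_rkhs ::
  "('a \<Rightarrow> 'a \<Rightarrow> real) \<Rightarrow> ('a \<Rightarrow> real) set \<Rightarrow> (('a \<Rightarrow> real) \<Rightarrow> ('a \<Rightarrow> real) \<Rightarrow> real) \<Rightarrow> bool" where
  "is_rkhs k H ip \<longleftrightarrow>
     inner_on H ip \<and>
     Metric_space.mcomplete H (ip_dist ip) \<and>
     (\<forall>y. (\<lambda>x. k x y) \<in> H) \<and>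
     (\<forall>f\<in>H. \<forall>y. ip f (\<lambda>x. k x y) = f y)"

text \<open>
  By the Moore--Aronszajn theorem every kernel has exactly one reproducing kernel Hilbert space
  (the pair is unique because \<open>ip\<close> is fixed outside \<open>H\<close>), so the choice below is determined.
\<close>

definition rkhs ::
  "('a \<Rightarrow> 'a \<Rightarrow> real) \<Rightarrow> ('a \<Rightarrow> real) set \<times> (('a \<Rightarrow> real) \<Rightarrow> ('a \<Rightarrow> real) \<Rightarrow> real)" where
  "rkhs k = (SOME (H, ip). is_rkhs k H ip)"

abbreviation rkhs_carrier :: "('a \<Rightarrow> 'a \<Rightarrow> real) \<Rightarrow> ('a \<Rightarrow> real) set" where
  "rkhs_carrier k \<equiv> fst (rkhs k)"

abbreviation rkhs_inner ::
  "('a \<Rightarrow> 'a \<Rightarrow> real) \<Rightarrow> ('a \<Rightarrow> real) \<Rightarrow> ('a \<Rightarrow> real) \<Rightarrow> real" where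
  "rkhs_inner k \<equiv> snd (rkhs k)"


text \<open>
  The Bochner integral of a function with values in \<open>(H, ip)\<close>.  The definitions transcribe
  those of \<^theory>\<open>HOL-Analysis.Bochner_Integration\<close>, with the norm and Borel sets of the type replaced
  by those of \<open>(H, ip)\<close>.
\<close>

definition simple_integrable_on ::
  "('a \<Rightarrow> real) set \<Rightarrow> 'b measure \<Rightarrow> ('b \<Rightarrow> 'a \<Rightarrow> real) \<Rightarrow> bool" where
  "simple_integrable_on H M s \<longleftrightarrow>
     simple_function M s \<and> s ` space M \<subseteq> H \<and>
     emeasure M {\<omega> \<in> space M. s \<omega> \<noteq> (\<lambda>x. 0)} \<noteq> \<infinity>"

definition simple_integral_fun :: "'b measure \<Rightarrow> ('b \<Rightarrow> 'a \<Rightarrow> real) \<Rightarrow> 'a \<Rightarrow> real" where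
  "simple_integral_fun M s =
     (\<lambda>x. \<Sum>h\<in>s ` space M. measure M {\<omega> \<in> space M. s \<omega> = h} * h x)"

definition borel_on ::
  "('a \<Rightarrow> real) set \<Rightarrow> (('a \<Rightarrow> real) \<Rightarrow> ('a \<Rightarrow> real) \<Rightarrow> real) \<Rightarrow> ('a \<Rightarrow> real) measure" where
  "borel_on H ip = sigma H {U. openin (Metric_space.mtopology H (ip_dist ip)) U}"

definition has_bochner_integral_on ::
  "('a \<Rightarrow> real) set \<Rightarrow> (('a \<Rightarrow> real) \<Rightarrow> ('a \<Rightarrow> real) \<Rightarrow> real) \<Rightarrow>
   'b measure \<Rightarrow> ('b \<Rightarrow> 'a \<Rightarrow> real) \<Rightarrow> ('a \<Rightarrow> real) \<Rightarrow> bool" where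
  "has_bochner_integral_on H ip M f I \<longleftrightarrow>
     f \<in> measurable M (borel_on H ip) \<and> I \<in> H \<and>
     (\<exists>s :: nat \<Rightarrow> 'b \<Rightarrow> 'a \<Rightarrow> real.
        (\<forall>n. simple_integrable_on H M (s n)) \<and>
        (\<lambda>n. \<integral>\<^sup>+\<omega>. ennreal (ip_dist ip (f \<omega>) (s n \<omega>)) \<partial>M) \<longlonglongrightarrow> 0 \<and>
        (\<lambda>n. ip_dist ip (simple_integral_fun M (s n)) I) \<longlonglongrightarrow> 0)"

definition bochner_integral_on ::
  "('a \<Rightarrow> real) set \<Rightarrow> (('a \<Rightarrow> real) \<Rightarrow> ('a \<Rightarrow> real) \<Rightarrow> real) \<Rightarrow>
   'b measure \<Rightarrow> ('b \<Rightarrow> 'a \<Rightarrow> real) \<Rightarrow> 'a \<Rightarrow> real" where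
  "bochner_integral_on H ip M f = (THE I. has_bochner_integral_on H ip M f I)"


definition mean_embedding :: "('a \<Rightarrow> 'a \<Rightarrow> real) \<Rightarrow> 'a measure \<Rightarrow> 'a \<Rightarrow> real" where
  "mean_embedding k P =
     bochner_integral_on (rkhs_carrier k) (rkhs_inner k) P (\<lambda>y. (\<lambda>x. k x y))"

definition MMD :: "('a \<Rightarrow> 'a \<Rightarrow> real) \<Rightarrow> 'a measure \<Rightarrow> 'a measure \<Rightarrow> real" where
  "MMD k P Q = ip_norm (rkhs_inner k) (\<lambda>x. mean_embedding k P x - mean_embedding k Q x)"

text \<open>
  Intended for bounded measurable kernels, for which the mean embeddings of all Borel
  probability measures are defined.
\<close>

definition characteristic :: "('a::topological_space \<Rightarrow> 'a \<Rightarrow> real) \<Rightarrow> bool" where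
  "characteristic k \<longleftrightarrow>
     (\<forall>P Q. borel_prob P \<and> borel_prob Q \<and> MMD k P Q = 0 \<longrightarrow> P = Q)"

end

theory Submission
  imports Defs
begin

text \<open>
  A measure of full support forces the space to be separable, so every Borel probability measure
  \<open>P\<close> has the mean embedding \<open>x \<mapsto> \<integral>k(x, y) dP(y)\<close> in the RKHS of \<open>k\<close>.  If the embeddings of \<open>P\<close> and
  \<open>Q\<close> agree, write \<open>D\<close> for the difference of the Fourier transforms of \<open>P\<close> and \<open>Q\<close>; Fubini turns
  \<open>\<integral>\<integral>k d(P - Q) d(P - Q) = 0\<close> into \<open>\<integral>\<bar>D\<bar>\<^sup>2 d\<mu> = 0\<close>.  As \<open>D\<close> is continuous and \<open>\<mu>\<close> has full support,
  \<open>D = 0\<close>.  Finally \<open>P = Q\<close>, because Levy's one-dimensional uniqueness theorem, applied along one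
  direction after the other, shows that \<open>P\<close> and \<open>Q\<close> agree on finite intersections of half-spaces.
\<close>

section \<open>Inner product spaces of functions\<close>

text \<open>\<open>rkhs\<close> is a choice, so nothing can be said about it before some space
  satisfying \<open>is_rkhs\<close> has been exhibited; hence the construction of an RKHS from
  scratch. Separability does three jobs. It yields simple functions \<open>e n\<close> converging
  pointwise to the identity, and composing the feature map with them gives the approximants of the
  Bochner integral. The same \<open>e n\<close> make \<open>exp (i <x, v>)\<close> measurable for
  the product of the two Borel sigma-algebras, as Fubini requires; continuity alone does not ensure
  this on large spaces. Finally, it lets half-spaces generate all Borel sets. The last part is
  shaped by the fact that half-spaces are not closed under intersection, so equality of all
  one-dimensional projections does not directly give equality on an Int-stable generator. The
  induction over half-spaces therefore carries the full Fourier transform of the restricted measure,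
  not just its mass.\<close>

locale function_inner_space =
  fixes H :: "('a \<Rightarrow> real) set" and ip :: "('a \<Rightarrow> real) \<Rightarrow> ('a \<Rightarrow> real) \<Rightarrow> real"
  assumes inner_on: "inner_on H ip"
begin

lemma zero_mem [simp]: "(\<lambda>x. 0) \<in> H"
  and add_mem: "f \<in> H \<Longrightarrow> g \<in> H \<Longrightarrow> (\<lambda>x. f x + g x) \<in> H"
  and scale_mem: "f \<in> H \<Longrightarrow> (\<lambda>x. c * f x) \<in> H"
  and ip_outside: "f \<notin> H \<or> g \<notin> H \<Longrightarrow> ip f g = 0"
  and ip_commute: "f \<in> H \<Longrightarrow> g \<in> H \<Longrightarrow> ip f g = ip g f"
  and ip_add_left: "f \<in> H \<Longrightarrow> g \<in> H \<Longrightarrow> h \<in> H \<Longrightarrow> ip (\<lambda>x. f x + g x) h = ip f h + ip g h"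
  and ip_scale_left: "f \<in> H \<Longrightarrow> g \<in> H \<Longrightarrow> ip (\<lambda>x. c * f x) g = c * ip f g"
  and ip_self_nonneg: "f \<in> H \<Longrightarrow> 0 \<le> ip f f"
  and ip_self_eq_0: "f \<in> H \<Longrightarrow> ip f f = 0 \<Longrightarrow> f = (\<lambda>x. 0)"
  using inner_on unfolding inner_on_def by blast+

lemma diff_mem: "f \<in> H \<Longrightarrow> g \<in> H \<Longrightarrow> (\<lambda>x. f x - g x) \<in> H"
  using add_mem[of f "\<lambda>x. (-1) * g x"] scale_mem[of g "-1"] by simp

lemma diff_mem_commute: "(\<lambda>x. f x - g x) \<in> H \<longleftrightarrow> (\<lambda>x. g x - f x) \<in> H"
  using scale_mem[of "\<lambda>x. f x - g x" "-1"] scale_mem[of "\<lambda>x. g x - f x" "-1"] by auto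

lemma ip_diff_left:
  "f \<in> H \<Longrightarrow> g \<in> H \<Longrightarrow> h \<in> H \<Longrightarrow> ip (\<lambda>x. f x - g x) h = ip f h - ip g h"
  using ip_add_left[of f "\<lambda>x. (-1) * g x" h] scale_mem[of g "-1"] ip_scale_left[of g h "-1"]
  by simp

lemma ip_add_right:
  "f \<in> H \<Longrightarrow> g \<in> H \<Longrightarrow> h \<in> H \<Longrightarrow> ip h (\<lambda>x. f x + g x) = ip h f + ip h g"
  using ip_add_left[of f g h] ip_commute[of h] add_mem[of f g] by simp

lemma ip_diff_right:
  "f \<in> H \<Longrightarrow> g \<in> H \<Longrightarrow> h \<in> H \<Longrightarrow> ip h (\<lambda>x. f x - g x) = ip h f - ip h g"
  using ip_diff_left[of f g h] ip_commute[of h] diff_mem[of f g] by simp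

lemma ip_scale_right: "f \<in> H \<Longrightarrow> g \<in> H \<Longrightarrow> ip g (\<lambda>x. c * f x) = c * ip g f"
  using ip_scale_left[of f g c] ip_commute[of g] scale_mem[of f c] by simp

lemma ip_zero_left [simp]: "ip (\<lambda>x. 0) g = 0"
  using ip_scale_left[of "\<lambda>x. 0" g 0] ip_outside[of "\<lambda>x. 0" g] by (cases "g \<in> H") auto

lemma sum_mem: "(\<And>i. i \<in> I \<Longrightarrow> f i \<in> H) \<Longrightarrow> (\<lambda>x. \<Sum>i\<in>I. c i * f i x) \<in> H"
proof (induction I rule: infinite_finite_induct)
  case (insert i I)
  then show ?case using add_mem[OF scale_mem[of "f i" "c i"]] by simp
qed auto

lemma ip_sum_left:
  "(\<And>i. i \<in> I \<Longrightarrow> f i \<in> H) \<Longrightarrow> g \<in> H \<Longrightarrow>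
    ip (\<lambda>x. \<Sum>i\<in>I. c i * f i x) g = (\<Sum>i\<in>I. c i * ip (f i) g)"
proof (induction I rule: infinite_finite_induct)
  case (insert i I)
  then show ?case
    using ip_add_left[OF scale_mem[of "f i" "c i"] sum_mem[of I f c], of g] ip_scale_left[of "f i" g]
    by simp
qed auto

lemma ip_norm_nonneg [simp]: "0 \<le> ip_norm ip f"
  unfolding ip_norm_def using ip_self_nonneg[of f] ip_outside[of f f] by (cases "f \<in> H") auto

lemma ip_norm_power2: "f \<in> H \<Longrightarrow> (ip_norm ip f)\<^sup>2 = ip f f"
  unfolding ip_norm_def by (simp add: ip_self_nonneg)

lemma ip_norm_eq_0: "f \<in> H \<Longrightarrow> ip_norm ip f = 0 \<Longrightarrow> f = (\<lambda>x. 0)"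
  using ip_norm_power2[of f] ip_self_eq_0[of f] by simp

lemma Cauchy_Schwarz:
  assumes f: "f \<in> H" and g: "g \<in> H"
  shows "\<bar>ip f g\<bar> \<le> ip_norm ip f * ip_norm ip g"
proof (cases "ip g g = 0")
  case True
  then have "g = (\<lambda>x. 0)" using ip_self_eq_0 g by blast
  then have "ip f g = 0" using ip_commute[OF f g] by simp
  then show ?thesis by simp
next
  case False
  then have pos: "0 < ip g g" using ip_self_nonneg[OF g] by simp
  \<comment> \<open>\<open>t * g\<close> is the orthogonal projection of \<open>f\<close> onto the
    line through \<open>g\<close>.\<close>
  define t where "t = ip f g / ip g g"
  have tg: "(\<lambda>x. t * g x) \<in> H" by (rule scale_mem[OF g])
  have d: "(\<lambda>x. f x - t * g x) \<in> H" by (rule diff_mem[OF f tg])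
  have "0 \<le> ip (\<lambda>x. f x - t * g x) (\<lambda>x. f x - t * g x)"
    by (rule ip_self_nonneg[OF d])
  also have "\<dots> = ip f f - 2 * t * ip f g + t\<^sup>2 * ip g g"
    using f g tg d ip_commute[OF f g]
    by (simp add: ip_diff_left ip_diff_right ip_scale_left ip_scale_right scale_mem
        power2_eq_square algebra_simps)
  also have "\<dots> = ip f f - (ip f g)\<^sup>2 / ip g g"
    using pos unfolding t_def by (simp add: power2_eq_square field_simps)
  finally have "(ip f g)\<^sup>2 \<le> ip f f * ip g g"
    using pos by (simp add: field_simps)
  then have "sqrt ((ip f g)\<^sup>2) \<le> sqrt (ip f f * ip g g)"
    by (rule real_sqrt_le_mono)
  then show ?thesis by (simp add: ip_norm_def real_sqrt_mult)
qed

lemma ip_norm_triangle: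
  assumes f: "f \<in> H" and g: "g \<in> H"
  shows "ip_norm ip (\<lambda>x. f x + g x) \<le> ip_norm ip f + ip_norm ip g"
proof (rule power2_le_imp_le)
  have "(ip_norm ip (\<lambda>x. f x + g x))\<^sup>2 = ip f f + 2 * ip f g + ip g g"
    using f g ip_commute[OF f g]
    by (simp add: ip_norm_power2 add_mem ip_add_left ip_add_right)
  also have "\<dots> \<le> ip f f + 2 * (ip_norm ip f * ip_norm ip g) + ip g g"
    using Cauchy_Schwarz[OF f g] by simp
  also have "\<dots> = (ip_norm ip f + ip_norm ip g)\<^sup>2"
    using f g by (simp add: ip_norm_power2[symmetric] power2_sum)
  finally show "(ip_norm ip (\<lambda>x. f x + g x))\<^sup>2 \<le> (ip_norm ip f + ip_norm ip g)\<^sup>2" .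
qed simp

text \<open>\<open>Metric_space\<close> demands symmetry for all functions, also those outside
  \<open>H\<close>. If \<open>f - g\<close> is not in \<open>H\<close>, neither is
  \<open>g - f\<close>, and both distances are 0 by the convention on \<open>ip\<close>.\<close>

lemma ip_dist_commute: "ip_dist ip f g = ip_dist ip g f"
proof (cases "(\<lambda>x. f x - g x) \<in> H")
  case True
  have "ip (\<lambda>x. (-1) * (f x - g x)) (\<lambda>x. (-1) * (f x - g x))
      = ip (\<lambda>x. f x - g x) (\<lambda>x. f x - g x)"
    using True scale_mem[OF True, of "-1"]
    by (simp only: ip_scale_left[OF True] ip_scale_right[OF True])
  then show ?thesis by (simp add: ip_dist_def ip_norm_def)
next
  case False
  then show ?thesis
    using diff_mem_commute[of f g] by (simp add: ip_dist_def ip_norm_def ip_outside)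
qed

sublocale Metric_space H "ip_dist ip"
proof
  fix f g h
  show "0 \<le> ip_dist ip f g" by (simp add: ip_dist_def)
  show "ip_dist ip f g = ip_dist ip g f" by (rule ip_dist_commute)
  assume f: "f \<in> H" and g: "g \<in> H"
  show "ip_dist ip f g = 0 \<longleftrightarrow> f = g"
  proof
    assume "ip_dist ip f g = 0"
    then have "(\<lambda>x. f x - g x) = (\<lambda>x. 0)"
      unfolding ip_dist_def by (rule ip_norm_eq_0[OF diff_mem[OF f g]])
    then show "f = g" by (simp add: fun_eq_iff)
  qed (simp add: ip_dist_def ip_norm_def)
  assume h: "h \<in> H"
  show "ip_dist ip f h \<le> ip_dist ip f g + ip_dist ip g h"
    using ip_norm_triangle[OF diff_mem[OF f g] diff_mem[OF g h]] by (simp add: ip_dist_def)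
qed

end


section \<open>The Jordan--von Neumann theorem\<close>

text \<open>The deviation \<open>D\<close> from linearity is additive and vanishes at the integers,
  so it has period 1 and is bounded as on [0, 1]; since \<open>D (n * t) = n * D t\<close>, a
  bounded \<open>D\<close> must be 0. The growth bound plays the part of continuity in the usual
  proof of homogeneity.\<close>

lemma additive_quadratic_bound_imp_linear:
  fixes \<phi> :: "real \<Rightarrow> real"
  assumes add: "\<And>s t. \<phi> (s + t) = \<phi> s + \<phi> t"
    and bound: "\<And>t. \<bar>\<phi> t\<bar> \<le> A * t\<^sup>2 + B"
  shows "\<phi> t = t * \<phi> 1"
proof -
  define D where "D t = \<phi> t - t * \<phi> 1" for t
  have Dadd: "D (s + t) = D s + D t" for s t
    by (simp add: D_def add algebra_simps)
  have Dnat: "D (real n * t) = real n * D t" for n t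
  proof (induction n)
    case 0
    show ?case using Dadd[of 0 0] by simp
  next
    case (Suc n)
    then show ?case using Dadd[of "real n * t" t] by (simp add: algebra_simps)
  qed
  have D1: "D 1 = 0" by (simp add: D_def)
  have Dn0: "D (real n) = 0" for n using Dnat[of n 1] D1 by simp
  have Dint: "D (of_int z) = 0" for z
  proof (cases z)
    case (nonneg n)
    then show ?thesis using Dn0 by simp
  next
    case (neg n)
    have "D (real (Suc n)) + D (- real (Suc n)) = 0"
      using Dadd[of "real (Suc n)" "- real (Suc n)"] Dadd[of 0 0] by simp
    then show ?thesis using neg Dn0[of "Suc n"] by simp
  qed
  \<comment> \<open>Bounds \<open>D\<close> on [0, 1], where
    \<open>t\<^sup>2 \<le> 1\<close>.\<close>
  define M where "M = \<bar>A\<bar> + \<bar>B\<bar> + \<bar>\<phi> 1\<bar>"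
  have DM: "\<bar>D t\<bar> \<le> M" for t
  proof -
    let ?s = "frac t"
    have s: "0 \<le> ?s" "?s \<le> 1" using frac_lt_1[of t] by (auto intro: less_imp_le)
    have "D t = D ?s"
      using Dadd[of "of_int \<lfloor>t\<rfloor>" "frac t"] Dint[of "\<lfloor>t\<rfloor>"] by (simp add: frac_def)
    also have "\<bar>\<dots>\<bar> \<le> \<bar>\<phi> ?s\<bar> + \<bar>?s * \<phi> 1\<bar>" unfolding D_def by linarith
    also have "\<bar>\<phi> ?s\<bar> \<le> \<bar>A\<bar> + \<bar>B\<bar>"
    proof -
      have "A * ?s\<^sup>2 \<le> \<bar>A\<bar> * ?s\<^sup>2" by (intro mult_right_mono) auto
      also have "\<dots> \<le> \<bar>A\<bar> * 1" using s by (intro mult_left_mono) (auto simp: power_le_one)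
      finally show ?thesis using bound[of ?s] by linarith
    qed
    also have "\<bar>?s * \<phi> 1\<bar> \<le> \<bar>\<phi> 1\<bar>"
      using s by (simp add: abs_mult mult_left_le_one_le)
    finally show ?thesis by (simp add: M_def)
  qed
  have "D t = 0"
  proof (rule ccontr)
    assume "D t \<noteq> 0"
    then obtain n where "M < real n * \<bar>D t\<bar>"
      using reals_Archimedean3[of "\<bar>D t\<bar>"] by auto
    then show False using DM[of "real n * t"] Dnat[of n t] by (simp add: abs_mult)
  qed
  then show ?thesis by (simp add: D_def)
qed

text \<open>The hypotheses speak of a squared norm \<open>E\<close> because the construction below
  produces one as a supremum, with no triangle inequality at hand. The parallelogram laws for
  \<open>f + g\<close>, \<open>h\<close> and for \<open>f - g\<close>, \<open>h\<close> subtract to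
  the midpoint identity \<open>B_half\<close>, which yields additivity.\<close>

lemma Jordan_von_Neumann:
  fixes H :: "('a \<Rightarrow> real) set" and E :: "('a \<Rightarrow> real) \<Rightarrow> real"
  assumes zero: "(\<lambda>x. 0) \<in> H"
    and add: "\<And>f g. f \<in> H \<Longrightarrow> g \<in> H \<Longrightarrow> (\<lambda>x. f x + g x) \<in> H"
    and scale: "\<And>c f. f \<in> H \<Longrightarrow> (\<lambda>x. c * f x) \<in> H"
    and E_nonneg: "\<And>f. f \<in> H \<Longrightarrow> 0 \<le> E f"
    and E_eq_0: "\<And>f. f \<in> H \<Longrightarrow> E f = 0 \<Longrightarrow> f = (\<lambda>x. 0)"
    and E_scale: "\<And>c f. f \<in> H \<Longrightarrow> E (\<lambda>x. c * f x) = c\<^sup>2 * E f"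
    and parallelogram: "\<And>f g. f \<in> H \<Longrightarrow> g \<in> H \<Longrightarrow>
      E (\<lambda>x. f x + g x) + E (\<lambda>x. f x - g x) = 2 * E f + 2 * E g"
  defines "ip \<equiv> \<lambda>f g. if f \<in> H \<and> g \<in> H
      then (E (\<lambda>x. f x + g x) - E (\<lambda>x. f x - g x)) / 4 else 0"
  shows "inner_on H ip" and "\<And>f. f \<in> H \<Longrightarrow> ip f f = E f"
proof -
  define B where "B f g = E (\<lambda>x. f x + g x) - E (\<lambda>x. f x - g x)" for f g
  have diff: "(\<lambda>x. f x - g x) \<in> H" if "f \<in> H" "g \<in> H" for f g
    using add[OF that(1) scale[OF that(2), of "-1"]] by simp
  have E0: "E (\<lambda>x. 0) = 0" using E_scale[OF zero, of 0] by simp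
  have E_minus: "E (\<lambda>x. - f x) = E f" if "f \<in> H" for f
    using E_scale[OF that, of "-1"] by simp
  have E_diff_commute: "E (\<lambda>x. f x - g x) = E (\<lambda>x. g x - f x)" if "f \<in> H" "g \<in> H" for f g
    using E_minus[OF diff[OF that]] by simp
  have B_half: "B (\<lambda>x. f x + h x) g + B (\<lambda>x. f x - h x) g = 2 * B f g"
    if "f \<in> H" "g \<in> H" "h \<in> H" for f g h
    using parallelogram[OF add[OF that(1,2)] that(3)]
      parallelogram[OF diff[OF that(1,2)] that(3)]
    unfolding B_def by (simp add: algebra_simps)
  have B0: "B (\<lambda>x. 0) g = 0" if "g \<in> H" for g
    unfolding B_def using E_minus[OF that] by simp
  have B_double: "B (\<lambda>x. f x + f x) g = 2 * B f g" if "f \<in> H" "g \<in> H" for f g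
    using B_half[OF that that(1)] B0[OF that(2)] by simp
  have B_add: "B (\<lambda>x. f x + h x) g = B f g + B h g"
    if f: "f \<in> H" and h: "h \<in> H" and g: "g \<in> H" for f h g
  proof -
    \<comment> \<open>Midpoint and half-difference: for \<open>?u\<close> and \<open>?w\<close> the
      left side of \<open>B_half\<close> is \<open>B f g + B h g\<close>, and its right side becomes
      \<open>B (f + h) g\<close> by doubling.\<close>
    let ?u = "\<lambda>x. (1/2) * (f x + h x)" and ?w = "\<lambda>x. (1/2) * (f x - h x)"
    have u: "?u \<in> H" and w: "?w \<in> H"
      by (rule scale[OF add[OF f h]]) (rule scale[OF diff[OF f h]])
    have 1: "(\<lambda>x. ?u x + ?w x) = f" "(\<lambda>x. ?u x - ?w x) = h" "(\<lambda>x. ?u x + ?u x) = (\<lambda>x. f x + h x)"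
      by (auto simp: field_simps)
    show ?thesis using B_half[OF u g w] B_double[OF u g] unfolding 1 by simp
  qed
  have B_scale: "B (\<lambda>x. c * f x) g = c * B f g" if f: "f \<in> H" and g: "g \<in> H" for f g c
  proof -
    have "B (\<lambda>x. c * f x) g = c * B (\<lambda>x. 1 * f x) g"
    proof (rule additive_quadratic_bound_imp_linear[where \<phi> = "\<lambda>c. B (\<lambda>x. c * f x) g"
          and A = "2 * E f" and B = "2 * E g"])
      fix s t
      show "B (\<lambda>x. (s + t) * f x) g = B (\<lambda>x. s * f x) g + B (\<lambda>x. t * f x) g"
        using B_add[OF scale[OF f] scale[OF f] g, of s t] by (simp add: distrib_right)
      have tf: "(\<lambda>x. t * f x) \<in> H" by (rule scale[OF f])
      \<comment> \<open>Both terms of \<open>B\<close> are nonnegative, so its modulus is at most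
        their sum, which the parallelogram law evaluates.\<close>
      show "\<bar>B (\<lambda>x. t * f x) g\<bar> \<le> 2 * E f * t\<^sup>2 + 2 * E g"
        using parallelogram[OF tf g] E_scale[OF f, of t] E_nonneg[OF add[OF tf g]]
          E_nonneg[OF diff[OF tf g]]
        unfolding B_def by (simp add: algebra_simps)
    qed
    then show ?thesis by simp
  qed
  have ip_B: "ip f g = B f g / 4" if "f \<in> H" "g \<in> H" for f g
    using that by (simp add: ip_def B_def)
  show ip_self: "ip f f = E f" if "f \<in> H" for f
    using ip_B[OF that that] E_scale[OF that, of 2] E0 unfolding B_def by simp
  have B_commute: "B f g = B g f" if "f \<in> H" "g \<in> H" for f g
    unfolding B_def using E_diff_commute[OF that] by (simp add: add.commute)
  show "inner_on H ip"
    unfolding inner_on_def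
  proof (intro conjI ballI allI impI)
    show "ip f g = 0" if "f \<notin> H \<or> g \<notin> H" for f g
      using that by (auto simp: ip_def)
    show "f = (\<lambda>x. 0)" if "f \<in> H" "ip f f = 0" for f
      using that ip_self E_eq_0 by simp
    show "ip f g = ip g f" if "f \<in> H" "g \<in> H" for f g
      using that by (simp add: ip_B B_commute[OF that])
    show "ip (\<lambda>x. f x + g x) h = ip f h + ip g h" if "f \<in> H" "g \<in> H" "h \<in> H" for f g h
      using that by (simp add: ip_B add B_add add_divide_distrib)
    show "ip (\<lambda>x. c * f x) g = c * ip f g" if "f \<in> H" "g \<in> H" for c f g
      using that by (simp add: ip_B scale B_scale)
    show "0 \<le> ip f f" if "f \<in> H" for f
      using that by (simp add: ip_self E_nonneg)
  qed (use zero add scale in auto)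
qed


section \<open>The Moore--Aronszajn theorem\<close>

text \<open>
  A list of pairs \<open>(a, x)\<close> stands for the functional \<open>f \<mapsto> \<Sum> a * f x\<close>.  A function \<open>f\<close>
  belongs to the RKHS iff \<open>c \<mapsto> 2 * c f - \<parallel>c\<parallel>\<^sup>2\<close> is bounded above on these functionals, and the
  supremum is then the squared norm of \<open>f\<close>.
\<close>

definition lfun :: "(real \<times> 'a) list \<Rightarrow> ('a \<Rightarrow> real) \<Rightarrow> real" where
  "lfun c f = (\<Sum>(a, x)\<leftarrow>c. a * f x)"

definition lfun_scale :: "real \<Rightarrow> (real \<times> 'a) list \<Rightarrow> (real \<times> 'a) list" where
  "lfun_scale t = map (\<lambda>(a, x). (t * a, x))"

lemma lfun_Nil [simp]: "lfun [] f = 0"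
  and lfun_Cons [simp]: "lfun ((a, x) # c) f = a * f x + lfun c f"
  and lfun_append [simp]: "lfun (c @ d) f = lfun c f + lfun d f"
  by (simp_all add: lfun_def)

lemma lfun_lfun_scale [simp]: "lfun (lfun_scale t c) f = t * lfun c f"
  by (induction c) (auto simp: lfun_scale_def algebra_simps)

lemma lfun_add [simp]: "lfun c (\<lambda>x. f x + g x) = lfun c f + lfun c g"
  and lfun_diff [simp]: "lfun c (\<lambda>x. f x - g x) = lfun c f - lfun c g"
  and lfun_scale_right [simp]: "lfun c (\<lambda>x. t * f x) = t * lfun c f"
  and lfun_zero [simp]: "lfun c (\<lambda>x. 0) = 0"
  by (induction c) (auto simp: algebra_simps)

lemma lfun_swap: "lfun c (\<lambda>x. lfun d (k x)) = lfun d (\<lambda>y. lfun c (\<lambda>x. k x y))"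
  by (induction c) auto

lemma tendsto_lfun:
  "(\<And>x. (\<lambda>n. f n x) \<longlonglongrightarrow> g x) \<Longrightarrow> (\<lambda>n. lfun c (f n)) \<longlonglongrightarrow> lfun c g"
  by (induction c) (auto intro!: tendsto_intros)

lemma lfun_eq_sum: "lfun c f = (\<Sum>i<length c. fst (c ! i) * f (snd (c ! i)))"
  unfolding lfun_def by (simp add: sum_list_sum_nth split_beta atLeast0LessThan)

locale kernel =
  fixes k :: "'a \<Rightarrow> 'a \<Rightarrow> real"
  assumes kernel: "is_kernel k"
begin

section \<open>The quadratic form of a kernel and the energy of a function\<close>

definition gram :: "(real \<times> 'a) list \<Rightarrow> (real \<times> 'a) list \<Rightarrow> real" where
  "gram c d = lfun c (\<lambda>x. lfun d (k x))"

text \<open>If \<open>f\<close> is the kernel combination given by a list \<open>d\<close>, then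
  \<open>lfun c f = gram c d\<close>, and completing the square shows the supremum to be
  \<open>gram d d\<close>, attained at \<open>c = d\<close>. The supremum thus extends the squared
  norm from the span of the kernel sections to arbitrary functions, with neither quotient nor
  completion.\<close>

definition energy_set :: "('a \<Rightarrow> real) \<Rightarrow> real set" where
  "energy_set f = range (\<lambda>c. 2 * lfun c f - gram c c)"

definition energy :: "('a \<Rightarrow> real) \<Rightarrow> real" where
  "energy f = Sup (energy_set f)"

definition finite_energy :: "('a \<Rightarrow> real) set" where
  "finite_energy = {f. bdd_above (energy_set f)}"

lemma kernel_commute: "k x y = k y x"
  using kernel by (simp add: is_kernel_def)

lemma gram_append_left [simp]: "gram (c @ c') d = gram c d + gram c' d"
  and gram_append_right [simp]: "gram c (d @ d') = gram c d + gram c d'"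
  and gram_scale_left [simp]: "gram (lfun_scale t c) d = t * gram c d"
  and gram_scale_right [simp]: "gram c (lfun_scale t d) = t * gram c d"
  and gram_Nil [simp]: "gram [] d = 0"
  by (simp_all add: gram_def)

lemma gram_commute: "gram c d = gram d c"
proof -
  have "(\<lambda>x. k x y) = k y" for y by (rule ext) (rule kernel_commute)
  then show ?thesis unfolding gram_def by (subst lfun_swap) simp
qed

lemma gram_point_right: "gram c [(a, y)] = a * lfun c (\<lambda>x. k x y)"
  by (simp add: gram_def)

lemma gram_self_nonneg: "0 \<le> gram c c"
proof -
  have "gram c c = (\<Sum>i<length c. \<Sum>j<length c.
      fst (c ! i) * fst (c ! j) * k (snd (c ! i)) (snd (c ! j)))"
    by (simp add: gram_def lfun_eq_sum sum_distrib_left mult.assoc)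
  moreover have "0 \<le> (\<Sum>i<n. \<Sum>j<n. a i * a j * k (x i) (x j))" for n :: nat and a x
    using kernel unfolding is_kernel_def by blast
  ultimately show ?thesis by simp
qed

lemma energy_upper: "f \<in> finite_energy \<Longrightarrow> 2 * lfun c f - gram c c \<le> energy f"
  unfolding finite_energy_def energy_def
  by (rule cSup_upper) (auto simp: energy_set_def)

lemma energy_least:
  assumes "\<And>c. 2 * lfun c f - gram c c \<le> b"
  shows "f \<in> finite_energy" "energy f \<le> b"
proof -
  show "f \<in> finite_energy"
    unfolding finite_energy_def energy_set_def using assms by (auto intro!: bdd_aboveI)
  show "energy f \<le> b"
    unfolding energy_def by (rule cSup_least) (use assms in \<open>auto simp: energy_set_def\<close>)
qed

lemma energy_nonneg: "f \<in> finite_energy \<Longrightarrow> 0 \<le> energy f"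
  using energy_upper[of f "[]"] by simp

lemma zero_mem: "(\<lambda>x. 0) \<in> finite_energy" and energy_zero: "energy (\<lambda>x. 0) = 0"
proof -
  have le: "2 * lfun c (\<lambda>x. 0) - gram c c \<le> 0" for c
    using gram_self_nonneg[of c] by simp
  show "(\<lambda>x. 0) \<in> finite_energy" by (rule energy_least[OF le])
  then show "energy (\<lambda>x. 0) = 0"
    using energy_least(2)[OF le] energy_nonneg[of "\<lambda>x. 0"] by simp
qed

lemma scale_mem: "(\<lambda>x. t * f x) \<in> finite_energy"
  and energy_scale_le: "energy (\<lambda>x. t * f x) \<le> t\<^sup>2 * energy f"
  if f: "f \<in> finite_energy"
proof -
  have le: "2 * lfun c (\<lambda>x. t * f x) - gram c c \<le> t\<^sup>2 * energy f" for c
  proof (cases "t = 0")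
    case True
    then show ?thesis using gram_self_nonneg[of c] by simp
  next
    case False
    \<comment> \<open>Writing \<open>c\<close> as \<open>t\<close> times \<open>?c\<close> extracts
      the factor \<open>t\<^sup>2\<close> from the linear and the quadratic term alike.\<close>
    let ?c = "lfun_scale (1 / t) c"
    have "2 * lfun c (\<lambda>x. t * f x) - gram c c = t\<^sup>2 * (2 * lfun ?c f - gram ?c ?c)"
      using False by (simp add: field_simps power2_eq_square)
    also have "\<dots> \<le> t\<^sup>2 * energy f"
      by (rule mult_left_mono[OF energy_upper[OF f]]) simp
    finally show ?thesis .
  qed
  show "(\<lambda>x. t * f x) \<in> finite_energy" "energy (\<lambda>x. t * f x) \<le> t\<^sup>2 * energy f"
    by (rule energy_least[OF le])+
qed

lemma energy_scale:
  assumes f: "f \<in> finite_energy"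
  shows "energy (\<lambda>x. t * f x) = t\<^sup>2 * energy f"
proof (cases "t = 0")
  case False
  have "energy (\<lambda>x. (1 / t) * (t * f x)) \<le> (1 / t)\<^sup>2 * energy (\<lambda>x. t * f x)"
    by (rule energy_scale_le[OF scale_mem[OF f]])
  then have "t\<^sup>2 * energy f \<le> energy (\<lambda>x. t * f x)"
    using False by (simp add: field_simps)
  then show ?thesis using energy_scale_le[OF f, of t] by simp
qed (simp add: energy_zero)

text \<open>Substitute \<open>p = (c + d) / 2\<close> and \<open>q = (c - d) / 2\<close> in the two suprema.\<close>

lemma parallelogram_aux:
  assumes f: "f \<in> finite_energy" and g: "g \<in> finite_energy"
  shows "(2 * lfun c (\<lambda>x. f x + g x) - gram c c) + (2 * lfun d (\<lambda>x. f x - g x) - gram d d)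
    \<le> 2 * energy f + 2 * energy g"
proof -
  let ?p = "lfun_scale (1/2) (c @ d)" and ?q = "lfun_scale (1/2) (c @ lfun_scale (- 1) d)"
  have "(2 * lfun c (\<lambda>x. f x + g x) - gram c c) + (2 * lfun d (\<lambda>x. f x - g x) - gram d d)
      = 2 * (2 * lfun ?p f - gram ?p ?p) + 2 * (2 * lfun ?q g - gram ?q ?q)"
    by (simp add: algebra_simps)
  also have "\<dots> \<le> 2 * energy f + 2 * energy g"
    by (intro add_mono mult_left_mono energy_upper f g) auto
  finally show ?thesis .
qed

lemma add_mem:
  assumes f: "f \<in> finite_energy" and g: "g \<in> finite_energy"
  shows "(\<lambda>x. f x + g x) \<in> finite_energy"
  \<comment> \<open>The zero functional \<open>[]\<close> makes the second bracket vanish.\<close>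
  using parallelogram_aux[OF f g, where d = "[]"]
  by (intro energy_least(1)[where b = "2 * energy f + 2 * energy g"]) simp

lemma diff_mem:
  assumes f: "f \<in> finite_energy" and g: "g \<in> finite_energy"
  shows "(\<lambda>x. f x - g x) \<in> finite_energy"
  using add_mem[OF f scale_mem[OF g, of "- 1"]] by simp

text \<open>The two suprema are taken one after the other: over \<open>d\<close> with
  \<open>c\<close> fixed, then over \<open>c\<close>.\<close>

lemma parallelogram_le:
  assumes f: "f \<in> finite_energy" and g: "g \<in> finite_energy"
  shows "energy (\<lambda>x. f x + g x) + energy (\<lambda>x. f x - g x) \<le> 2 * energy f + 2 * energy g"
proof -
  have "energy (\<lambda>x. f x - g x)
      \<le> 2 * energy f + 2 * energy g - (2 * lfun c (\<lambda>x. f x + g x) - gram c c)" for c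
  proof (rule energy_least(2))
    fix d
    show "2 * lfun d (\<lambda>x. f x - g x) - gram d d
        \<le> 2 * energy f + 2 * energy g - (2 * lfun c (\<lambda>x. f x + g x) - gram c c)"
      using parallelogram_aux[OF f g, of c d] by linarith
  qed
  then have "2 * lfun c (\<lambda>x. f x + g x) - gram c c
      \<le> 2 * energy f + 2 * energy g - energy (\<lambda>x. f x - g x)" for c
    by (simp add: algebra_simps)
  then have "energy (\<lambda>x. f x + g x) \<le> 2 * energy f + 2 * energy g - energy (\<lambda>x. f x - g x)"
    by (rule energy_least(2))
  then show ?thesis by simp
qed

text \<open>The reverse inequality is \<open>parallelogram_le\<close> for \<open>f + g\<close> and
  \<open>f - g\<close>, whose sum and difference are \<open>2 * f\<close> and \<open>2 * g\<close>,
  combined with quadratic homogeneity.\<close>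

lemma parallelogram:
  assumes f: "f \<in> finite_energy" and g: "g \<in> finite_energy"
  shows "energy (\<lambda>x. f x + g x) + energy (\<lambda>x. f x - g x) = 2 * energy f + 2 * energy g"
proof (rule antisym[OF parallelogram_le[OF f g]])
  have "energy (\<lambda>x. 2 * f x) + energy (\<lambda>x. 2 * g x)
      \<le> 2 * energy (\<lambda>x. f x + g x) + 2 * energy (\<lambda>x. f x - g x)"
    using parallelogram_le[OF add_mem[OF f g] diff_mem[OF f g]] by simp
  then show "2 * energy f + 2 * energy g \<le> energy (\<lambda>x. f x + g x) + energy (\<lambda>x. f x - g x)"
    using energy_scale[OF f, of 2] energy_scale[OF g, of 2] by simp
qed

section \<open>Point evaluations and the reproducing property\<close>

lemma power2_le_energy:
  assumes f: "f \<in> finite_energy"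
  shows "(f y)\<^sup>2 \<le> (k y y + 1) * energy f"
proof -
  have k: "0 \<le> k y y" using gram_self_nonneg[of "[(1, y)]"] by (simp add: gram_def)
  \<comment> \<open>The optimal multiple of the evaluation at \<open>y\<close> would be
    \<open>f y / k y y\<close>; adding 1 keeps the denominator positive when
    \<open>k y y = 0\<close>.\<close>
  define s where "s = f y / (k y y + 1)"
  have "2 * (s * f y) - s * (s * k y y) \<le> energy f"
    using energy_upper[OF f, of "[(s, y)]"] by (simp add: gram_def)
  moreover have "s * (s * k y y) \<le> s * (s * (k y y + 1))"
    by (simp add: distrib_left)
  moreover have "s * (k y y + 1) = f y" using k by (simp add: s_def)
  ultimately have "s * f y \<le> energy f" by simp
  then have "(k y y + 1) * (s * f y) \<le> (k y y + 1) * energy f"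
    using k by (intro mult_left_mono) auto
  moreover have "(k y y + 1) * (s * f y) = (f y)\<^sup>2"
    using k by (simp add: s_def power2_eq_square)
  ultimately show ?thesis by simp
qed

lemma energy_eq_0: "f \<in> finite_energy \<Longrightarrow> energy f = 0 \<Longrightarrow> f = (\<lambda>x. 0)"
  using power2_le_energy[of f] by (auto simp: fun_eq_iff)

text \<open>Completing the square: testing \<open>f + t * k _ y\<close> with \<open>c\<close> is
  testing \<open>f\<close> with \<open>c\<close> minus \<open>t\<close> times the evaluation at
  \<open>y\<close>, up to the terms \<open>2 * t * f y + t\<^sup>2 * k y y\<close>.\<close>

lemma energy_shift_le:
  assumes f: "f \<in> finite_energy"
  shows "(\<lambda>x. f x + t * k x y) \<in> finite_energy"
    and "energy (\<lambda>x. f x + t * k x y) \<le> energy f + 2 * t * f y + t\<^sup>2 * k y y"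
proof -
  have le: "2 * lfun c (\<lambda>x. f x + t * k x y) - gram c c
      \<le> energy f + 2 * t * f y + t\<^sup>2 * k y y" for c
  proof -
    have "gram [(- t, y)] c = - t * lfun c (\<lambda>x. k x y)"
      using gram_commute gram_point_right by metis
    moreover have "gram [(- t, y)] [(- t, y)] = t\<^sup>2 * k y y"
      by (simp add: gram_def power2_eq_square)
    ultimately show ?thesis
      using energy_upper[OF f, of "c @ [(- t, y)]"] gram_point_right[of c "- t" y]
      by (simp add: algebra_simps)
  qed
  show "(\<lambda>x. f x + t * k x y) \<in> finite_energy"
    "energy (\<lambda>x. f x + t * k x y) \<le> energy f + 2 * t * f y + t\<^sup>2 * k y y"
    by (rule energy_least[OF le])+
qed

text \<open>The opposite inequality is the bound for the shifted function and \<open>- t\<close>.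
  The cases \<open>t = 1\<close> and \<open>t = - 1\<close> differ by \<open>4 * f y\<close>, which
  is the reproducing property after polarization.\<close>

lemma energy_shift:
  assumes f: "f \<in> finite_energy"
  shows "energy (\<lambda>x. f x + t * k x y) = energy f + 2 * t * f y + t\<^sup>2 * k y y"
  using energy_shift_le[OF f, of t y] energy_shift_le(2)[OF energy_shift_le(1)[OF f, of t y], of "- t" y]
  by (simp add: power2_eq_square algebra_simps)

lemma section_mem: "(\<lambda>x. k x y) \<in> finite_energy"
  using energy_shift_le(1)[OF zero_mem, of 1 y] by simp

definition energy_ip :: "('a \<Rightarrow> real) \<Rightarrow> ('a \<Rightarrow> real) \<Rightarrow> real" where
  "energy_ip f g = (if f \<in> finite_energy \<and> g \<in> finite_energy
     then (energy (\<lambda>x. f x + g x) - energy (\<lambda>x. f x - g x)) / 4 else 0)"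

lemma inner_on_energy_ip: "inner_on finite_energy energy_ip"
  and energy_ip_self: "f \<in> finite_energy \<Longrightarrow> energy_ip f f = energy f"
  unfolding energy_ip_def[abs_def]
  by (rule Jordan_von_Neumann[of finite_energy energy, OF zero_mem add_mem scale_mem energy_nonneg
      energy_eq_0 energy_scale parallelogram]; assumption)+

lemma energy_ip_section: "f \<in> finite_energy \<Longrightarrow> energy_ip f (\<lambda>x. k x y) = f y"
  using energy_shift[of f 1 y] energy_shift[of f "- 1" y] section_mem[of y]
  by (simp add: energy_ip_def)

sublocale energy: function_inner_space finite_energy energy_ip
  by standard (rule inner_on_energy_ip)

text \<open>Energy controls point values, so a Cauchy sequence has a pointwise limit. Each term of
  the supremum defining \<open>energy\<close> involves finitely many values, so
  \<open>energy\<close> is lower semicontinuous under pointwise convergence and the Cauchy estimates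
  pass to the limit.\<close>

lemma mcomplete_finite_energy: "energy.mcomplete"
  unfolding energy.mcomplete_def
proof (intro allI impI)
  fix f assume "energy.MCauchy f"
  then have mem: "\<And>n. f n \<in> finite_energy"
    and Cauchy: "\<And>\<epsilon>. 0 < \<epsilon> \<Longrightarrow>
      \<exists>N. \<forall>m n. N \<le> m \<longrightarrow> N \<le> n \<longrightarrow> ip_dist energy_ip (f m) (f n) < \<epsilon>"
    unfolding energy.MCauchy_def by auto
  have dist: "(ip_dist energy_ip u v)\<^sup>2 = energy (\<lambda>x. u x - v x)"
    if "u \<in> finite_energy" "v \<in> finite_energy" for u v
    using energy.ip_norm_power2[OF diff_mem[OF that]] energy_ip_self[OF diff_mem[OF that]]
    by (simp add: ip_dist_def)
  have "Cauchy (\<lambda>n. f n y)" for y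
  proof (rule metric_CauchyI)
    fix \<epsilon> :: real assume "0 < \<epsilon>"
    have k: "0 \<le> k y y" using gram_self_nonneg[of "[(1, y)]"] by (simp add: gram_def)
    define C where "C = sqrt (k y y + 1)"
    have C: "0 < C" "C\<^sup>2 = k y y + 1" using k by (auto simp: C_def)
    obtain N where N: "\<And>m n. N \<le> m \<Longrightarrow> N \<le> n \<Longrightarrow> ip_dist energy_ip (f m) (f n) < \<epsilon> / C"
      using Cauchy[of "\<epsilon> / C"] \<open>0 < \<epsilon>\<close> C by auto
    have "dist (f m y) (f n y) < \<epsilon>" if "N \<le> m" "N \<le> n" for m n
    proof -
      have "(f m y - f n y)\<^sup>2 \<le> (C * ip_dist energy_ip (f m) (f n))\<^sup>2"
        using power2_le_energy[OF diff_mem[OF mem[of m] mem[of n]], of y] dist[OF mem[of m] mem[of n]] C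
        by (simp add: power_mult_distrib)
      then have "\<bar>f m y - f n y\<bar> \<le> C * ip_dist energy_ip (f m) (f n)"
        using C by (auto simp: abs_le_square_iff[symmetric])
      also have "\<dots> < \<epsilon>" using N[OF that] C by (simp add: field_simps)
      finally show ?thesis by (simp add: dist_real_def)
    qed
    then show "\<exists>M. \<forall>m\<ge>M. \<forall>n\<ge>M. dist (f m y) (f n y) < \<epsilon>" by blast
  qed
  then have "\<exists>l. (\<lambda>n. f n y) \<longlonglongrightarrow> l" for y
    using Cauchy_convergent convergent_def by blast
  then obtain g where g: "\<And>y. (\<lambda>n. f n y) \<longlonglongrightarrow> g y" by metis
  \<comment> \<open>With \<open>n\<close> and the test functional \<open>c\<close> fixed,
    \<open>m\<close> tends to infinity; only then is the supremum over \<open>c\<close>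
    taken.\<close>
  have close: "(\<lambda>x. f n x - g x) \<in> finite_energy \<and> energy (\<lambda>x. f n x - g x) \<le> \<epsilon>\<^sup>2"
    if N: "\<And>m n. N \<le> m \<Longrightarrow> N \<le> n \<Longrightarrow> ip_dist energy_ip (f m) (f n) < \<epsilon>" and n: "N \<le> n"
    for N n \<epsilon>
  proof -
    have "2 * lfun c (\<lambda>x. f n x - g x) - gram c c \<le> \<epsilon>\<^sup>2" for c
    proof (rule LIMSEQ_le_const2)
      show "(\<lambda>m. 2 * lfun c (\<lambda>x. f n x - f m x) - gram c c)
          \<longlonglongrightarrow> 2 * lfun c (\<lambda>x. f n x - g x) - gram c c"
        using g by (intro tendsto_intros tendsto_lfun)
      have "2 * lfun c (\<lambda>x. f n x - f m x) - gram c c \<le> \<epsilon>\<^sup>2" if m: "N \<le> m" for m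
      proof -
        have "energy (\<lambda>x. f n x - f m x) \<le> \<epsilon>\<^sup>2"
          unfolding dist[OF mem mem, symmetric]
          using N[OF n m] by (intro power_mono) auto
        then show ?thesis using energy_upper[OF diff_mem[OF mem[of n] mem[of m]], of c] by linarith
      qed
      then show "\<exists>N. \<forall>m\<ge>N. 2 * lfun c (\<lambda>x. f n x - f m x) - gram c c \<le> \<epsilon>\<^sup>2" by blast
    qed
    then show ?thesis using energy_least by blast
  qed
  have g_mem: "g \<in> finite_energy"
  proof -
    obtain N where "\<And>m n. N \<le> m \<Longrightarrow> N \<le> n \<Longrightarrow> ip_dist energy_ip (f m) (f n) < 1"
      using Cauchy[of 1] by auto
    then have "(\<lambda>x. f N x - (f N x - g x)) \<in> finite_energy"
      using close[of N 1 N] diff_mem[OF mem[of N], of "\<lambda>x. f N x - g x"] by auto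
    then show ?thesis by simp
  qed
  have "\<exists>N. \<forall>n\<ge>N. f n \<in> finite_energy \<and> ip_dist energy_ip (f n) g < \<epsilon>" if "0 < \<epsilon>" for \<epsilon>
  proof -
    obtain N where N: "\<And>m n. N \<le> m \<Longrightarrow> N \<le> n \<Longrightarrow> ip_dist energy_ip (f m) (f n) < \<epsilon> / 2"
      using Cauchy[OF half_gt_zero[OF \<open>0 < \<epsilon>\<close>]] by blast
    have "ip_dist energy_ip (f n) g < \<epsilon>" if "N \<le> n" for n
    proof -
      have "(ip_dist energy_ip (f n) g)\<^sup>2 \<le> (\<epsilon> / 2)\<^sup>2"
        using close[OF N that] dist[OF mem g_mem] by simp
      then have "ip_dist energy_ip (f n) g \<le> \<epsilon> / 2"
        by (rule power2_le_imp_le) (use \<open>0 < \<epsilon>\<close> in simp)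
      then show ?thesis using \<open>0 < \<epsilon>\<close> by simp
    qed
    then show ?thesis using mem by blast
  qed
  then show "\<exists>g. limitin energy.mtopology f g sequentially"
    using g_mem by (auto simp: energy.limit_metric_sequentially)
qed

theorem Moore_Aronszajn: "is_rkhs k finite_energy energy_ip"
  unfolding is_rkhs_def
  using inner_on_energy_ip mcomplete_finite_energy section_mem energy_ip_section by blast

text \<open>The choice in \<open>rkhs\<close> meets its specification once a witness exists. Later
  arguments use this property of the chosen pair and not the constructed space.\<close>

lemma is_rkhs_rkhs: "is_rkhs k (rkhs_carrier k) (rkhs_inner k)"
proof -
  have "case rkhs k of (H, ip) \<Rightarrow> is_rkhs k H ip"
    unfolding rkhs_def by (rule someI_ex) (use Moore_Aronszajn in auto)
  then show ?thesis by (simp add: split_beta)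
qed

end


section \<open>Full support and separability\<close>

text \<open>Balls of radius \<open>e / 2\<close> around the points of a maximal \<open>e\<close>-separated set are disjoint and have
  positive measure, so there are only countably many of them.\<close>

lemma full_support_imp_countable_net:
  fixes \<mu> :: "'a::metric_space measure"
  assumes "finite_measure \<mu>" "sets \<mu> = sets borel" "full_support \<mu>" "0 < e"
  obtains D :: "'a set" where "countable D" "\<And>x. \<exists>y\<in>D. dist x y < e"
proof -
  interpret finite_measure \<mu> by fact
  let ?A = "{S::'a set. pairwise (\<lambda>x y. e \<le> dist x y) S}"
  \<comment> \<open>Separation constrains two points at a time, and two points of the union of a
    chain lie in a common member, so Zorn's lemma applies.\<close>
  have "\<exists>M\<in>?A. \<forall>X\<in>?A. M \<subseteq> X \<longrightarrow> X = M"
  proof (rule subset_Zorn')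
    fix \<C> assume c: "subset.chain ?A \<C>"
    show "\<Union>\<C> \<in> ?A"
    proof (clarsimp simp: pairwise_def)
      fix x y X Y assume xy: "x \<in> X" "X \<in> \<C>" "y \<in> Y" "Y \<in> \<C>" "x \<noteq> y"
      have "X \<subseteq> Y \<or> Y \<subseteq> X" using c xy unfolding subset_chain_def by blast
      moreover have "X \<in> ?A" "Y \<in> ?A" using c xy unfolding subset_chain_def by blast+
      ultimately show "e \<le> dist x y" using xy by (auto simp: pairwise_def)
    qed
  qed
  then obtain D where "D \<in> ?A" and "\<forall>X\<in>?A. D \<subseteq> X \<longrightarrow> X = D" by (rule bexE)
  then have D: "pairwise (\<lambda>x y. e \<le> dist x y) D"
    and max: "\<And>X. pairwise (\<lambda>x y. e \<le> dist x y) X \<Longrightarrow> D \<subseteq> X \<Longrightarrow> X = D"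
    by simp_all
  have net: "\<exists>y\<in>D. dist x y < e" for x
  proof (rule ccontr)
    assume far: "\<not> (\<exists>y\<in>D. dist x y < e)"
    then have "pairwise (\<lambda>x y. e \<le> dist x y) (insert x D)"
      using D by (auto simp: pairwise_insert dist_commute not_less)
    then have "insert x D = D" by (rule max) auto
    then show False using far \<open>0 < e\<close> by (metis dist_self insertI1)
  qed
  let ?m = "\<lambda>x. measure \<mu> (ball x (e / 2))"
  have pos: "0 < ?m x" for x
    using \<open>full_support \<mu>\<close>[unfolded full_support_def, rule_format, of "ball x (e / 2)"] \<open>0 < e\<close>
    by (simp add: emeasure_eq_measure)
  have disj: "disjoint_family_on (\<lambda>x. ball x (e / 2)) D"
    unfolding disjoint_family_on_def
  proof (intro ballI impI)
    fix x y assume "x \<in> D" "y \<in> D" "x \<noteq> y"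
    then have "e \<le> dist x y" using D by (auto simp: pairwise_def)
    then show "ball x (e / 2) \<inter> ball y (e / 2) = {}" by (intro disjoint_ballI) simp
  qed
  \<comment> \<open>Sums over finite subsets of \<open>D\<close> are masses of disjoint unions,
    hence at most the total mass. A summable real family has countable support, and by
    \<open>pos\<close> the support is all of \<open>D\<close>.\<close>
  have "?m summable_on D"
  proof (rule nonneg_bdd_above_summable_on)
    have "sum ?m F \<le> measure \<mu> (space \<mu>)" if F: "F \<subseteq> D" "finite F" for F
    proof -
      have "sum ?m F = measure \<mu> (\<Union>x\<in>F. ball x (e / 2))"
        using F disj \<open>sets \<mu> = sets borel\<close>
        by (intro finite_measure_finite_Union[symmetric])
           (auto intro: disjoint_family_on_mono[OF F(1)])
      then show ?thesis by (simp add: bounded_measure)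
    qed
    then show "bdd_above (sum ?m ` {F. F \<subseteq> D \<and> finite F})" by (auto intro!: bdd_aboveI2)
  qed simp
  then have "countable {x \<in> D. ?m x \<noteq> 0}" by (rule summable_countable_real)
  moreover have "{x \<in> D. ?m x \<noteq> 0} = D" using pos by (auto simp: less_le)
  ultimately have "countable D" by simp
  show thesis by (rule that[OF \<open>countable D\<close> net])
qed

lemma full_support_imp_dense_sequence:
  fixes \<mu> :: "'a::metric_space measure"
  assumes "finite_measure \<mu>" "sets \<mu> = sets borel" "full_support \<mu>"
  obtains d :: "nat \<Rightarrow> 'a" where "\<And>x e. 0 < e \<Longrightarrow> \<exists>i. dist x (d i) < e"
proof -
  have "\<exists>D::'a set. countable D \<and> (\<forall>x. \<exists>y\<in>D. dist x y < 1 / Suc n)" for n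
    using full_support_imp_countable_net[OF assms, of "1 / Suc n"] by (metis of_nat_0_less_iff zero_less_Suc zero_less_divide_1_iff)
  then obtain D :: "nat \<Rightarrow> 'a set" where D: "\<And>n. countable (D n)" "\<And>n x. \<exists>y\<in>D n. dist x y < 1 / Suc n"
    by metis
  let ?D = "\<Union>n. D n"
  have "countable ?D" "?D \<noteq> {}" using D(1) D(2)[of 0] by blast+
  then have range: "range (from_nat_into ?D) = ?D" by (rule range_from_nat_into[rotated])
  show thesis
  proof (rule that)
    fix x :: 'a and e :: real assume "0 < e"
    then obtain n where n: "1 / Suc n < e" using nat_approx_posE by blast
    obtain y where y: "y \<in> D n" "dist x y < 1 / Suc n" using D(2) by blast
    then have "y \<in> range (from_nat_into ?D)" unfolding range by blast
    then obtain i where "y = from_nat_into ?D i" by (rule rangeE)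
    then have "dist x (from_nat_into ?D i) < e" using y n by simp
    then show "\<exists>i. dist x (from_nat_into ?D i) < e" ..
  qed
qed

text \<open>\<open>e n\<close> sends a point to a nearest one among \<open>d 0\<close>, ...,
  \<open>d n\<close>. Taking the least index among ties makes the selection measurable, because each
  condition \<open>P n x j\<close> defines a closed set of \<open>x\<close>.\<close>

lemma dense_sequence_imp_simple_approximation:
  fixes d :: "nat \<Rightarrow> 'a::metric_space"
  assumes dense: "\<And>x e. 0 < e \<Longrightarrow> \<exists>i. dist x (d i) < e"
  obtains e :: "nat \<Rightarrow> 'a \<Rightarrow> 'a"
  where "\<And>n. simple_function borel (e n)" "\<And>x. (\<lambda>n. e n x) \<longlonglongrightarrow> x"
proof -
  define P where "P n x j \<longleftrightarrow> j \<le> n \<and> (\<forall>i\<le>n. dist x (d j) \<le> dist x (d i))" for n x j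
  define T where "T n x = (LEAST j. P n x j)" for n x
  have ex: "\<exists>j. P n x j" for n x
    using ex_is_arg_min_if_finite[of "{..n}" "\<lambda>i. dist x (d i)"]
    by (auto simp: P_def is_arg_min_linorder)
  have T: "P n x (T n x)" for n x unfolding T_def using ex by (rule LeastI_ex)
  have "closed {x. P n x j}" for n j
    unfolding P_def
    by (intro closed_Collect_conj closed_Collect_all closed_Collect_imp closed_Collect_le
        closed_Collect_const open_Collect_const continuous_intros)
  then have [measurable]: "Measurable.pred borel (\<lambda>x. P n x j)" for n j
    unfolding pred_def by simp
  have Tm: "T n \<in> measurable borel (count_space UNIV)" for n
    unfolding T_def by measurable
  show thesis
  proof (rule that)
    fix n
    have "(\<lambda>x. d (T n x)) ` UNIV \<subseteq> d ` {..n}" using T by (auto simp: P_def)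
    then have "finite ((\<lambda>x. d (T n x)) ` UNIV)" by (rule finite_subset) simp
    moreover have "(\<lambda>x. d (T n x)) -` {y} \<in> sets borel" for y
      using measurable_sets[OF Tm, of "d -` {y}" n] by (simp add: vimage_def)
    ultimately show "simple_function borel (\<lambda>x. d (T n x))" by (simp add: simple_function_def)
  next
    fix x
    show "(\<lambda>n. d (T n x)) \<longlonglongrightarrow> x"
    proof (rule metric_LIMSEQ_I)
      fix r :: real assume "0 < r"
      then obtain i where i: "dist x (d i) < r" using dense by blast
      have "dist (d (T n x)) x < r" if "i \<le> n" for n
        using T[of n x] i that by (auto simp: P_def dist_commute intro: le_less_trans)
      then show "\<exists>no. \<forall>n\<ge>no. dist (d (T n x)) x < r" by blast
    qed
  qed
qed

text \<open>Once \<open>x\<close> is replaced by \<open>e n x\<close>, only finitely many sections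
  \<open>f y\<close> occur, each measurable in \<open>v\<close> alone; continuity in
  \<open>x\<close> then gives the limit. The conclusion concerns the product of the Borel
  sigma-algebras, not the Borel sets of the product space.\<close>

lemma simple_approximation_measurable_pair:
  fixes e :: "nat \<Rightarrow> 'a::metric_space \<Rightarrow> 'a"
    and f :: "'a \<Rightarrow> 'b::topological_space \<Rightarrow> 'c::metric_space"
  assumes e: "\<And>n. simple_function borel (e n)" "\<And>x. (\<lambda>n. e n x) \<longlonglongrightarrow> x"
    and f1: "\<And>v. continuous_on UNIV (\<lambda>x. f x v)"
    and f2: "\<And>x. continuous_on UNIV (f x)"
  shows "(\<lambda>(x, v). f x v) \<in> borel_measurable (borel \<Otimes>\<^sub>M borel)"
proof (rule borel_measurable_LIMSEQ_metric)
  fix n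
  have "(\<lambda>z. f (e n (fst z)) (snd z)) \<in> borel_measurable (borel \<Otimes>\<^sub>M borel)"
  proof (rule measurable_compose_countable'[where I = "e n ` UNIV"
        and f = "\<lambda>y z. f y (snd z)" and g = "\<lambda>z. e n (fst z)"])
    fix y
    have "f y \<in> borel_measurable borel" by (rule borel_measurable_continuous_onI[OF f2])
    then show "(\<lambda>z. f y (snd z)) \<in> borel_measurable (borel \<Otimes>\<^sub>M borel)" by measurable
  next
    have "e n \<in> measurable borel (count_space UNIV)"
      using e(1) by (rule measurable_simple_function)
    then have "e n \<in> measurable borel (count_space (range (e n)))"
      by (auto simp: measurable_count_space_eq2_countable measurable_def)
    then show "(\<lambda>z. e n (fst z)) \<in> measurable (borel \<Otimes>\<^sub>M borel) (count_space (range (e n)))"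
      by measurable
  next
    show "countable (range (e n))"
      using simple_functionD(1)[OF e(1)[of n]] by (simp add: countable_finite)
  qed
  then show "(\<lambda>(x, v). f (e n x) v) \<in> borel_measurable (borel \<Otimes>\<^sub>M borel)"
    by (simp add: split_beta')
next
  fix z :: "'a \<times> 'b"
  have "(\<lambda>n. f (e n (fst z)) (snd z)) \<longlonglongrightarrow> f (fst z) (snd z)"
    by (rule continuous_on_tendsto_compose[OF f1 e(2)]) auto
  then show "(\<lambda>n. case z of (x, v) \<Rightarrow> f (e n x) v) \<longlonglongrightarrow> (case z of (x, v) \<Rightarrow> f x v)"
    by (simp add: split_beta')
qed


section \<open>Kernel mean embeddings\<close>

text \<open>On \<open>space M\<close>, \<open>L (s w)\<close> is a finite combination of indicators
  of the level sets of \<open>s\<close>. Later \<open>L\<close> is evaluation at a point or the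
  inner product with a fixed element, so that function-valued integrals are tested by scalar
  ones.\<close>

lemma simple_integral_eq:
  fixes L :: "('a \<Rightarrow> real) \<Rightarrow> real"
  assumes "finite_measure M" and s: "simple_function M s"
  shows "integrable M (\<lambda>w. L (s w))"
    and "(\<Sum>h\<in>s ` space M. measure M {w \<in> space M. s w = h} * L h) = (\<integral>w. L (s w) \<partial>M)"
proof -
  interpret finite_measure M by fact
  let ?A = "\<lambda>h. {w \<in> space M. s w = h}"
  have A: "?A h \<in> sets M" for h
    using simple_functionD(2)[OF s, of "{h}"] by (simp add: vimage_def Int_def conj_commute)
  have fin: "finite (s ` space M)" using s by (rule simple_functionD)
  have eq: "L (s w) = (\<Sum>h\<in>s ` space M. L h * indicator (?A h) w)" if "w \<in> space M" for w
  proof -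
    have "(\<Sum>h\<in>s ` space M. L h * indicator (?A h) w)
        = (\<Sum>h\<in>s ` space M. if h = s w then L h else 0)"
      by (rule sum.cong) (use that in \<open>auto simp: indicator_def\<close>)
    also have "\<dots> = L (s w)" using fin that by (simp add: sum.delta)
    finally show ?thesis by simp
  qed
  have int: "integrable M (\<lambda>w. L h * indicator (?A h) w)" for h
    using A[of h] by (intro integrable_mult_right integrable_real_indicator)
      (auto simp: emeasure_eq_measure)
  have "integrable M (\<lambda>w. \<Sum>h\<in>s ` space M. L h * indicator (?A h) w)"
    using int by (rule Bochner_Integration.integrable_sum)
  then show "integrable M (\<lambda>w. L (s w))"
    by (subst Bochner_Integration.integrable_cong[OF refl eq])
  have "(\<integral>w. L (s w) \<partial>M) = (\<integral>w. (\<Sum>h\<in>s ` space M. L h * indicator (?A h) w) \<partial>M)"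
    by (rule Bochner_Integration.integral_cong[OF refl eq])
  also have "\<dots> = (\<Sum>h\<in>s ` space M. \<integral>w. L h * indicator (?A h) w \<partial>M)"
    using int by (rule Bochner_Integration.integral_sum)
  also have "\<dots> = (\<Sum>h\<in>s ` space M. measure M (?A h) * L h)"
    using A by (simp add: mult.commute)
  finally show "(\<Sum>h\<in>s ` space M. measure M (?A h) * L h) = (\<integral>w. L (s w) \<partial>M)" by simp
qed

locale reproducing_kernel_space =
  fixes k :: "'a \<Rightarrow> 'a \<Rightarrow> real" and H ip
  assumes is_rkhs: "is_rkhs k H ip"

sublocale reproducing_kernel_space \<subseteq> function_inner_space H ip
  by standard (use is_rkhs in \<open>simp add: is_rkhs_def\<close>)

context reproducing_kernel_space
begin

abbreviation feature :: "'a \<Rightarrow> 'a \<Rightarrow> real" where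
  "feature y \<equiv> \<lambda>x. k x y"

lemma feature_mem [simp]: "feature y \<in> H"
  and reproducing: "f \<in> H \<Longrightarrow> ip f (feature y) = f y"
  and mcomplete: "mcomplete"
  using is_rkhs by (auto simp: is_rkhs_def)

lemma kernel_commute: "k x y = k y x"
  using ip_commute[OF feature_mem feature_mem, of x y] by (simp add: reproducing)

lemma norm_feature: "ip_norm ip (feature y) = sqrt (k y y)"
  by (simp add: ip_norm_def reproducing)

lemma abs_apply_le: "f \<in> H \<Longrightarrow> \<bar>f y\<bar> \<le> ip_norm ip f * sqrt (k y y)"
  using Cauchy_Schwarz[of f "feature y"] by (simp add: reproducing norm_feature)

lemma dist_feature: "ip_dist ip (feature y) (feature z) = sqrt (k y y - 2 * k y z + k z z)"
  unfolding ip_dist_def ip_norm_def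
  using kernel_commute[of z y]
  by (simp add: ip_diff_left ip_diff_right diff_mem reproducing)

lemma dist_feature_le: "ip_dist ip (feature y) (feature z) \<le> sqrt (k y y) + sqrt (k z z)"
  using triangle[of "feature y" "\<lambda>x. 0" "feature z"] ip_dist_commute[of "\<lambda>x. 0" "feature z"]
  by (simp add: ip_dist_def[of _ _ "\<lambda>x. 0"] norm_feature)

text \<open>Evaluation at \<open>x\<close> is a bounded functional by Cauchy-Schwarz with
  \<open>feature x\<close>, so it commutes with the limit of the simple integrals. This gives the
  uniqueness behind the description \<open>THE\<close> in
  \<open>bochner_integral_on\<close>.\<close>

lemma has_bochner_integral_on_feature_eq:
  assumes "finite_measure M" and I: "has_bochner_integral_on H ip M feature I"
    and int: "integrable M (k x)"
  shows "I x = (\<integral>y. k x y \<partial>M)"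
proof -
  interpret finite_measure M by fact
  obtain s where s: "\<And>n. simple_integrable_on H M (s n)"
    and lim0: "(\<lambda>n. \<integral>\<^sup>+w. ennreal (ip_dist ip (feature w) (s n w)) \<partial>M) \<longlonglongrightarrow> 0"
    and limI: "(\<lambda>n. ip_dist ip (simple_integral_fun M (s n)) I) \<longlonglongrightarrow> 0"
    and "I \<in> H"
    using I unfolding has_bochner_integral_on_def by blast
  \<comment> \<open>\<open>sqrt (k x x)\<close> bounds the evaluation at \<open>x\<close>; the added
    1 permits division by \<open>C\<close>.\<close>
  define C where "C = sqrt (k x x) + 1"
  have kx: "0 \<le> sqrt (k x x)" using norm_feature[of x] ip_norm_nonneg[of "feature x"] by simp
  then have "0 < C" unfolding C_def by linarith
  have bound: "\<bar>f x - g x\<bar> \<le> C * ip_dist ip f g" if "f \<in> H" "g \<in> H" for f g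
  proof -
    have "\<bar>f x - g x\<bar> \<le> ip_dist ip f g * sqrt (k x x)"
      using abs_apply_le[OF diff_mem[OF that], of x] by (simp add: ip_dist_def)
    also have "\<dots> \<le> ip_dist ip f g * C" unfolding C_def by (intro mult_left_mono) auto
    finally show ?thesis by (simp add: mult.commute)
  qed
  have sm: "simple_function M (s n)" and sH: "w \<in> space M \<Longrightarrow> s n w \<in> H" for n w
    using s[of n] by (auto simp: simple_integrable_on_def)
  have S: "simple_integral_fun M (s n) x = (\<integral>w. s n w x \<partial>M)" for n
    unfolding simple_integral_fun_def
    by (rule simple_integral_eq(2)[OF assms(1) sm])
  have S_int: "integrable M (\<lambda>w. s n w x)" for n
    by (rule simple_integral_eq(1)[OF assms(1) sm, where L = "\<lambda>h. h x"])
  have J_mem: "simple_integral_fun M (s n) \<in> H" for n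
    unfolding simple_integral_fun_def using sH by (intro sum_mem) auto
  have "(\<lambda>n. simple_integral_fun M (s n) x - (\<integral>y. k x y \<partial>M)) \<longlonglongrightarrow> 0"
  proof (rule Lim_null_comparison)
    \<comment> \<open>Division by \<open>C\<close> puts the integrand below the distance of
      \<open>feature w\<close> and \<open>s n w\<close>, whose integrals tend to 0 by
      \<open>lim0\<close>.\<close>
    let ?a = "\<lambda>n. \<integral>w. \<bar>s n w x - k x w\<bar> / C \<partial>M"
    have a0: "0 \<le> ?a n" for n using \<open>0 < C\<close> by (intro integral_nonneg_AE) auto
    have "ennreal (?a n) \<le> (\<integral>\<^sup>+w. ennreal (ip_dist ip (feature w) (s n w)) \<partial>M)" for n
    proof -
      have "ennreal (?a n) = (\<integral>\<^sup>+w. ennreal (\<bar>s n w x - k x w\<bar> / C) \<partial>M)"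
        using S_int[of n] int \<open>0 < C\<close> by (intro nn_integral_eq_integral[symmetric]) auto
      also have "\<dots> \<le> (\<integral>\<^sup>+w. ennreal (ip_dist ip (feature w) (s n w)) \<partial>M)"
      proof (intro nn_integral_mono ennreal_leI)
        fix w assume "w \<in> space M"
        then show "\<bar>s n w x - k x w\<bar> / C \<le> ip_dist ip (feature w) (s n w)"
          using bound[OF sH feature_mem, of w n w] \<open>0 < C\<close> ip_dist_commute[of "feature w" "s n w"]
          by (simp add: field_simps)
      qed
      finally show ?thesis .
    qed
    then have "(\<lambda>n. ennreal (?a n)) \<longlonglongrightarrow> 0"
      by (intro tendsto_sandwich[OF _ _ tendsto_const lim0]) auto
    then have "?a \<longlonglongrightarrow> 0"
      using a0 by (simp add: ennreal_0[symmetric] tendsto_ennreal_iff del: ennreal_0)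
    then show "(\<lambda>n. C * ?a n) \<longlonglongrightarrow> 0" by (rule tendsto_mult_right_zero)
    have "norm (simple_integral_fun M (s n) x - (\<integral>y. k x y \<partial>M)) \<le> C * ?a n" for n
    proof -
      have "simple_integral_fun M (s n) x - (\<integral>y. k x y \<partial>M) = (\<integral>w. s n w x - k x w \<partial>M)"
        using S_int[of n] int by (simp add: S)
      also have "norm \<dots> \<le> (\<integral>w. \<bar>s n w x - k x w\<bar> \<partial>M)"
        using integral_norm_bound[of M "\<lambda>w. s n w x - k x w"] by simp
      also have "\<dots> = C * ?a n" using \<open>0 < C\<close> by simp
      finally show ?thesis .
    qed
    then show "\<forall>\<^sub>F n in sequentially.
        norm (simple_integral_fun M (s n) x - (\<integral>y. k x y \<partial>M)) \<le> C * ?a n" by simp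
  qed
  moreover have "(\<lambda>n. simple_integral_fun M (s n) x - I x) \<longlonglongrightarrow> 0"
  proof (rule Lim_null_comparison)
    show "(\<lambda>n. C * ip_dist ip (simple_integral_fun M (s n)) I) \<longlonglongrightarrow> 0"
      using limI by (rule tendsto_mult_right_zero)
    show "\<forall>\<^sub>F n in sequentially. norm (simple_integral_fun M (s n) x - I x)
        \<le> C * ip_dist ip (simple_integral_fun M (s n)) I"
      using bound[OF J_mem \<open>I \<in> H\<close>] by simp
  qed
  ultimately have "(\<lambda>n. (simple_integral_fun M (s n) x - (\<integral>y. k x y \<partial>M))
      - (simple_integral_fun M (s n) x - I x)) \<longlonglongrightarrow> 0 - 0" by (rule tendsto_diff)
  then have "(\<lambda>n::nat. I x - (\<integral>y. k x y \<partial>M)) \<longlonglongrightarrow> 0" by simp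
  then show ?thesis by (simp add: LIMSEQ_const_iff)
qed

text \<open>Testing the difference \<open>?g\<close> of the integrals against itself gives its
  squared norm, which Cauchy-Schwarz under the integral bounds by the right side times
  \<open>?N\<close>; then \<open>?N\<close> cancels. Going through scalar integrals avoids a common
  refinement of the level sets of \<open>u\<close> and \<open>v\<close>.\<close>

lemma dist_simple_integral_fun_le:
  assumes "finite_measure M" and "simple_function M u" "simple_function M v"
    and u: "\<And>w. w \<in> space M \<Longrightarrow> u w \<in> H" and v: "\<And>w. w \<in> space M \<Longrightarrow> v w \<in> H"
    and int: "integrable M (\<lambda>w. ip_dist ip (u w) (v w))"
  shows "ip_dist ip (simple_integral_fun M u) (simple_integral_fun M v)
    \<le> (\<integral>w. ip_dist ip (u w) (v w) \<partial>M)"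
proof -
  have U: "simple_integral_fun M u \<in> H" and V: "simple_integral_fun M v \<in> H"
    unfolding simple_integral_fun_def using u v by (auto intro!: sum_mem)
  let ?g = "\<lambda>x. simple_integral_fun M u x - simple_integral_fun M v x"
  let ?N = "ip_dist ip (simple_integral_fun M u) (simple_integral_fun M v)"
  have g: "?g \<in> H" by (rule diff_mem[OF U V])
  have weak: "ip (simple_integral_fun M f) ?g = (\<integral>w. ip (f w) ?g \<partial>M)"
    "integrable M (\<lambda>w. ip (f w) ?g)"
    if "simple_function M f" "\<And>w. w \<in> space M \<Longrightarrow> f w \<in> H" for f
    unfolding simple_integral_eq(2)[OF assms(1) that(1), where L = "\<lambda>h. ip h ?g", symmetric]
    using that simple_integral_eq(1)[OF assms(1) that(1), where L = "\<lambda>h. ip h ?g"]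
    by (auto simp: simple_integral_fun_def[of M f] intro!: ip_sum_left g)
  have "?N * ?N = ip ?g ?g"
    using ip_norm_power2[OF g] by (simp add: ip_dist_def power2_eq_square)
  also have "\<dots> = ip (simple_integral_fun M u) ?g - ip (simple_integral_fun M v) ?g"
    by (rule ip_diff_left[OF U V g])
  also have "\<dots> = (\<integral>w. ip (u w) ?g - ip (v w) ?g \<partial>M)"
    using weak[OF assms(2) u] weak[OF assms(3) v] by simp
  also have "\<dots> \<le> (\<integral>w. ip_dist ip (u w) (v w) * ?N \<partial>M)"
  proof (rule integral_mono)
    show "integrable M (\<lambda>w. ip (u w) ?g - ip (v w) ?g)"
      using weak[OF assms(2) u] weak[OF assms(3) v] by simp
    show "integrable M (\<lambda>w. ip_dist ip (u w) (v w) * ?N)" using int by simp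
    fix w assume w: "w \<in> space M"
    show "ip (u w) ?g - ip (v w) ?g \<le> ip_dist ip (u w) (v w) * ?N"
      using Cauchy_Schwarz[OF diff_mem[OF u[OF w] v[OF w]] g] ip_diff_left[OF u[OF w] v[OF w] g]
      by (simp add: ip_dist_def)
  qed
  also have "\<dots> = (\<integral>w. ip_dist ip (u w) (v w) \<partial>M) * ?N" by simp
  finally have "?N * ?N \<le> (\<integral>w. ip_dist ip (u w) (v w) \<partial>M) * ?N" .
  then show ?thesis
    using nonneg[of "simple_integral_fun M u" "simple_integral_fun M v"]
    by (cases "?N = 0") (auto simp: integral_nonneg_AE)
qed

end

section \<open>Existence of the mean embedding for bounded continuous kernels\<close>

locale continuous_kernel_space = reproducing_kernel_space k H ip
  for k :: "'a::metric_space \<Rightarrow> 'a \<Rightarrow> real" and H ip +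
  fixes B :: real
  assumes diag_le: "\<And>y. k y y \<le> B"
    and continuous_diag: "continuous_on UNIV (\<lambda>y. k y y)"
    and continuous_section: "\<And>y. continuous_on UNIV (k y)"
begin

lemma abs_kernel_le: "\<bar>k x y\<bar> \<le> B"
proof -
  have pos: "0 \<le> k x x" for x using ip_self_nonneg[OF feature_mem, of x] by (simp add: reproducing)
  have "\<bar>k x y\<bar> \<le> sqrt (k y y) * sqrt (k x x)"
    using abs_apply_le[OF feature_mem[of y], of x] by (simp add: norm_feature)
  also have "\<dots> \<le> sqrt B * sqrt B"
    using pos diag_le by (intro mult_mono) (auto intro: order_trans)
  also have "\<dots> = B" using pos[of x] diag_le[of x] by simp
  finally show ?thesis .
qed

lemma integrable_section:
  assumes "finite_measure P" and sets: "sets P = sets borel"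
  shows "integrable P (k x)"
proof (rule finite_measure.integrable_const_bound[OF assms(1), where B = B])
  show "k x \<in> borel_measurable P"
    using borel_measurable_continuous_onI[OF continuous_section] measurable_cong_sets[OF sets refl]
    by blast
qed (simp add: abs_kernel_le)

lemma continuous_dist_feature:
  "continuous_on UNIV (\<lambda>z. ip_dist ip (feature y) (feature z))"
  unfolding dist_feature by (intro continuous_intros continuous_diag continuous_section)

lemma measurable_feature:
  assumes sets: "sets P = sets borel"
  shows "feature \<in> measurable P (borel_on H ip)"
  unfolding borel_on_def
proof (rule measurable_measure_of)
  show "{U. openin mtopology U} \<subseteq> Pow H" using openin_mtopology by auto
  show "feature \<in> space P \<rightarrow> H" by simp
  fix U assume "U \<in> {U. openin mtopology U}"
  then have U: "\<And>f. f \<in> U \<Longrightarrow> \<exists>r>0. mball f r \<subseteq> U" by (auto simp: openin_mtopology)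
  have "open (feature -` U)"
  proof (subst open_subopen, safe)
    fix y assume "feature y \<in> U"
    then obtain r where r: "0 < r" "mball (feature y) r \<subseteq> U" using U by blast
    let ?T = "{z. ip_dist ip (feature y) (feature z) < r}"
    have "open ?T" by (intro open_Collect_less continuous_dist_feature continuous_intros)
    moreover have "y \<in> ?T" using r by simp
    moreover have "?T \<subseteq> feature -` U" using r(2) by (auto simp: subset_eq in_mball)
    ultimately show "\<exists>T. open T \<and> y \<in> T \<and> T \<subseteq> feature -` U" by blast
  qed
  then show "feature -` U \<inter> space P \<in> sets P"
    using sets sets_eq_imp_space_eq[OF sets] by simp
qed

text \<open>The approximants are \<open>feature\<close> composed with \<open>e n\<close>. They
  converge pointwise because \<open>feature\<close> is continuous, and in mean by dominated
  convergence since all distances are at most \<open>2 * sqrt B\<close>. Their integrals are then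
  Cauchy, and completeness of \<open>H\<close> supplies \<open>I\<close>.\<close>

lemma has_bochner_integral_on_feature:
  fixes e :: "nat \<Rightarrow> 'a \<Rightarrow> 'a"
  assumes "finite_measure P" and sets: "sets P = sets borel"
    and e: "\<And>n. simple_function borel (e n)" "\<And>x. (\<lambda>n. e n x) \<longlonglongrightarrow> x"
  shows "\<exists>I. has_bochner_integral_on H ip P feature I"
proof -
  interpret finite_measure P by fact
  have space: "space P = UNIV" using sets_eq_imp_space_eq[OF sets] by simp
  have eP: "simple_function P (e n)" for n
    using e(1)[of n] by (simp add: simple_function_def sets space)
  define s where "s n y = feature (e n y)" for n y
  have s: "simple_function P (s n)" for n
    using simple_function_compose[OF eP, of feature n] by (simp add: s_def[abs_def] o_def)
  have sH: "s n y \<in> H" for n y by (simp add: s_def)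
  \<comment> \<open>Splitting along the finitely many values of \<open>e n\<close> leaves distances
    to a fixed feature, which are continuous.\<close>
  have [measurable]: "(\<lambda>y. ip_dist ip (feature y) (s n y)) \<in> borel_measurable P" for n
  proof (rule measurable_compose_countable'[where I = "range (e n)"
        and f = "\<lambda>z y. ip_dist ip (feature y) (feature z)" and g = "e n", folded s_def])
    fix z
    show "(\<lambda>y. ip_dist ip (feature y) (feature z)) \<in> borel_measurable P"
      unfolding ip_dist_commute[of _ "feature z"]
      using borel_measurable_continuous_onI[OF continuous_dist_feature]
        measurable_cong_sets[OF sets refl] by blast
  next
    show "e n \<in> measurable P (count_space (range (e n)))"
      using measurable_simple_function[OF eP, of n] by (auto simp: measurable_def)
    show "countable (range (e n))"
      using simple_functionD(1)[OF eP, of n] by (simp add: space countable_finite)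
  qed
  have le: "ip_dist ip (feature y) (s n y) \<le> 2 * sqrt B" for n y
    using dist_feature_le[of y "e n y"] diag_le[of y] diag_le[of "e n y"]
    unfolding s_def by (smt (verit) real_sqrt_le_mono)
  have int: "integrable P (\<lambda>y. ip_dist ip (feature y) (s n y))" for n
    by (rule integrable_const_bound[where B = "2 * sqrt B"]) (auto simp: le)
  define b where "b n = (\<integral>y. ip_dist ip (feature y) (s n y) \<partial>P)" for n
  have "(\<lambda>n. b n) \<longlonglongrightarrow> (\<integral>y. 0 \<partial>P)"
    unfolding b_def
  proof (rule integral_dominated_convergence[where w = "\<lambda>_. 2 * sqrt B"])
    have "(\<lambda>n. ip_dist ip (feature y) (s n y)) \<longlonglongrightarrow> ip_dist ip (feature y) (feature y)" for y
      unfolding s_def by (rule continuous_on_tendsto_compose[OF continuous_dist_feature e(2)]) auto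
    then show "AE y in P. (\<lambda>n. ip_dist ip (feature y) (s n y)) \<longlonglongrightarrow> 0" by simp
  qed (auto simp: le)
  then have b0: "b \<longlonglongrightarrow> 0" by simp
  let ?J = "\<lambda>n. simple_integral_fun P (s n)"
  have J: "?J n \<in> H" for n
    unfolding simple_integral_fun_def using sH by (auto intro!: sum_mem)
  have dist_J: "ip_dist ip (?J n) (?J m) \<le> b n + b m" for n m
  proof -
    have tri: "ip_dist ip (s n y) (s m y)
        \<le> ip_dist ip (feature y) (s n y) + ip_dist ip (feature y) (s m y)" for y
      using triangle[OF sH[of n y] feature_mem[of y] sH[of m y]] ip_dist_commute[of "s n y" "feature y"]
      by simp
    have "simple_function P (\<lambda>y. (e n y, e m y))"
      using eP eP by (rule simple_function_Pair)
    from simple_function_compose[OF this, of "\<lambda>(u, v). ip_dist ip (feature u) (feature v)"]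
    have "simple_function P (\<lambda>y. ip_dist ip (s n y) (s m y))" by (simp add: o_def s_def)
    then have "(\<lambda>y. ip_dist ip (s n y) (s m y)) \<in> borel_measurable P"
      by (rule borel_measurable_simple_function)
    then have int': "integrable P (\<lambda>y. ip_dist ip (s n y) (s m y))"
      using tri
      by (intro Bochner_Integration.integrable_bound[OF Bochner_Integration.integrable_add[OF int[of n] int[of m]]])
         (auto intro: order_trans[OF _ abs_ge_self])
    have "ip_dist ip (?J n) (?J m) \<le> (\<integral>y. ip_dist ip (s n y) (s m y) \<partial>P)"
      by (intro dist_simple_integral_fun_le s sH int' assms(1))
    also have "\<dots> \<le> (\<integral>y. ip_dist ip (feature y) (s n y) + ip_dist ip (feature y) (s m y) \<partial>P)"
      by (intro integral_mono int' Bochner_Integration.integrable_add int tri)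
    also have "\<dots> = b n + b m" by (simp add: b_def int)
    finally show ?thesis .
  qed
  have "MCauchy ?J"
    unfolding MCauchy_def
  proof (intro conjI allI impI)
    show "range ?J \<subseteq> H" using J by auto
    fix \<epsilon> :: real assume "0 < \<epsilon>"
    then have "\<forall>\<^sub>F n in sequentially. b n < \<epsilon> / 2" using b0 by (intro order_tendstoD(2)) auto
    then obtain N where N: "\<And>n. N \<le> n \<Longrightarrow> b n < \<epsilon> / 2" by (auto simp: eventually_sequentially)
    have "ip_dist ip (?J n) (?J m) < \<epsilon>" if "N \<le> n" "N \<le> m" for n m
      using dist_J[of n m] N[OF that(1)] N[OF that(2)] by simp
    then show "\<exists>N. \<forall>n m. N \<le> n \<longrightarrow> N \<le> m \<longrightarrow> ip_dist ip (?J n) (?J m) < \<epsilon>" by blast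
  qed
  then obtain I where I: "limitin mtopology ?J I sequentially"
    using mcomplete unfolding mcomplete_def by blast
  have "has_bochner_integral_on H ip P feature I"
    unfolding has_bochner_integral_on_def
  proof (intro conjI exI[of _ s] allI)
    show "feature \<in> measurable P (borel_on H ip)" by (rule measurable_feature[OF sets])
    show "I \<in> H" using I by (simp add: limitin_metric)
    show "simple_integrable_on H P (s n)" for n
      using s sH by (auto simp: simple_integrable_on_def emeasure_eq_measure)
    have "(\<integral>\<^sup>+y. ennreal (ip_dist ip (feature y) (s n y)) \<partial>P) = ennreal (b n)" for n
      unfolding b_def by (rule nn_integral_eq_integral[OF int]) simp
    then show "(\<lambda>n. \<integral>\<^sup>+y. ennreal (ip_dist ip (feature y) (s n y)) \<partial>P) \<longlonglongrightarrow> 0"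
      using tendsto_ennrealI[OF b0] by simp
    show "(\<lambda>n. ip_dist ip (?J n) I) \<longlonglongrightarrow> 0"
    proof (rule LIMSEQ_I)
      fix r :: real assume "0 < r"
      then obtain N where "\<And>n. N \<le> n \<Longrightarrow> ip_dist ip (?J n) I < r"
        using I unfolding limit_metric_sequentially by blast
      then show "\<exists>no. \<forall>n\<ge>no. norm (ip_dist ip (?J n) I - 0) < r" by auto
    qed
  qed
  then show ?thesis by blast
qed

lemma bochner_integral_on_feature:
  fixes e :: "nat \<Rightarrow> 'a \<Rightarrow> 'a"
  assumes "finite_measure P" "sets P = sets borel"
    and "\<And>n. simple_function borel (e n)" "\<And>x. (\<lambda>n. e n x) \<longlonglongrightarrow> x"
  shows "bochner_integral_on H ip P feature = (\<lambda>x. \<integral>y. k x y \<partial>P)"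
    and "bochner_integral_on H ip P feature \<in> H"
proof -
  obtain I where I: "has_bochner_integral_on H ip P feature I"
    using has_bochner_integral_on_feature[OF assms] by blast
  have unique: "J = (\<lambda>x. \<integral>y. k x y \<partial>P)" if "has_bochner_integral_on H ip P feature J" for J
    using has_bochner_integral_on_feature_eq[OF assms(1) that integrable_section[OF assms(1,2)]]
    by blast
  have "has_bochner_integral_on H ip P feature (bochner_integral_on H ip P feature)"
    unfolding bochner_integral_on_def
    by (rule theI[of "has_bochner_integral_on H ip P feature" I]) (use I unique in auto)
  then show "bochner_integral_on H ip P feature = (\<lambda>x. \<integral>y. k x y \<partial>P)"
    "bochner_integral_on H ip P feature \<in> H"
    using unique by (auto simp: has_bochner_integral_on_def)
qed

end


section \<open>Fourier transforms determine measures\<close>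

lemma borel_measurable_continuous_sets_eq:
  fixes f :: "'a::topological_space \<Rightarrow> 'b::topological_space"
  assumes "sets M = sets borel" "continuous_on UNIV f"
  shows "f \<in> borel_measurable M"
  using borel_measurable_continuous_onI[OF assms(2)] measurable_cong_sets[OF assms(1) refl] by blast

lemma integrable_scaleR_iexp:
  fixes M :: "'a::real_inner measure" and g :: "'a \<Rightarrow> real"
  assumes "finite_measure M" and sets: "sets M = sets borel"
    and [measurable]: "g \<in> borel_measurable M" and bound: "\<And>x. \<bar>g x\<bar> \<le> C"
  shows "integrable M (\<lambda>x. g x *\<^sub>R iexp (w \<bullet> x))"
proof (rule finite_measure.integrable_const_bound[OF assms(1), where B = C])
  have [measurable]: "(\<lambda>x. iexp (w \<bullet> x)) \<in> borel_measurable M"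
    by (intro borel_measurable_continuous_sets_eq[OF sets] continuous_intros)
  show "(\<lambda>x. g x *\<^sub>R iexp (w \<bullet> x)) \<in> borel_measurable M" by measurable
qed (use bound in simp)

text \<open>Weighting \<open>M\<close> by \<open>h / c\<close> and projecting along \<open>v\<close>
  gives a distribution on the line whose characteristic function at \<open>t\<close> is
  \<open>1 / c\<close> times the given integral at \<open>w = t *\<^sub>R v\<close>. The
  one-dimensional theorem applies because the total weight \<open>c\<close> is common to both
  measures, by the case \<open>w = 0\<close>.\<close>

lemma Levy_uniqueness_weighted:
  fixes P Q :: "'a::real_inner measure" and h :: "'a \<Rightarrow> real"
  assumes "finite_measure P" "finite_measure Q"
    and P: "sets P = sets borel" and Q: "sets Q = sets borel"
    and h: "h \<in> borel_measurable borel" and nonneg: "\<And>x. 0 \<le> h x" and bound: "\<And>x. h x \<le> C"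
    and eq: "\<And>w. (\<integral>x. h x *\<^sub>R iexp (w \<bullet> x) \<partial>P) = (\<integral>x. h x *\<^sub>R iexp (w \<bullet> x) \<partial>Q)"
  shows "(\<integral>x. h x * indicator {x. v \<bullet> x \<le> b} x \<partial>P) = (\<integral>x. h x * indicator {x. v \<bullet> x \<le> b} x \<partial>Q)"
proof -
  define S where "S = {x. v \<bullet> x \<le> b}"
  have "closed S" unfolding S_def by (intro closed_Collect_le continuous_intros)
  then have S [measurable]: "S \<in> sets borel" by simp
  have int: "integrable M h" "integrable M (\<lambda>x. h x * indicator S x)"
    and meas: "h \<in> borel_measurable M" "(\<lambda>x. v \<bullet> x) \<in> borel_measurable M"
    if "finite_measure M" and sets: "sets M = sets borel" for M
  proof -
    show hM [measurable]: "h \<in> borel_measurable M"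
      using h measurable_cong_sets[OF sets refl] by blast
    have [measurable]: "S \<in> sets M" using S sets by simp
    show "integrable M h"
      by (rule finite_measure.integrable_const_bound[OF that(1), where B = C])
         (use nonneg bound in auto)
    show "integrable M (\<lambda>x. h x * indicator S x)"
      using nonneg by (intro finite_measure.integrable_const_bound[OF that(1), where B = C])
         (auto simp: indicator_def bound intro: order_trans[OF nonneg bound])
    show "(\<lambda>x. v \<bullet> x) \<in> borel_measurable M"
      by (intro borel_measurable_continuous_sets_eq[OF sets] continuous_intros)
  qed
  note intP = int[OF assms(1) P] and intQ = int[OF assms(2) Q]
  define c where "c = (\<integral>x. h x \<partial>P)"
  have "complex_of_real (\<integral>x. h x \<partial>P) = complex_of_real (\<integral>x. h x \<partial>Q)"
    using eq[of 0] by (simp add: scaleR_conv_of_real)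
  then have cQ: "(\<integral>x. h x \<partial>Q) = c" by (simp add: c_def)
  have "0 \<le> c" unfolding c_def using nonneg by (intro integral_nonneg_AE) auto
  have *: "0 \<le> (\<integral>x. h x * indicator S x \<partial>M)" "(\<integral>x. h x * indicator S x \<partial>M) \<le> (\<integral>x. h x \<partial>M)"
    if "finite_measure M" "sets M = sets borel" for M
  proof -
    show "0 \<le> (\<integral>x. h x * indicator S x \<partial>M)"
      using nonneg by (intro integral_nonneg_AE) auto
    show "(\<integral>x. h x * indicator S x \<partial>M) \<le> (\<integral>x. h x \<partial>M)"
      by (intro integral_mono int[OF that]) (use nonneg in \<open>auto simp: indicator_def\<close>)
  qed
  have "(\<integral>x. h x * indicator S x \<partial>P) = (\<integral>x. h x * indicator S x \<partial>Q)"
  proof (cases "c = 0")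
    \<comment> \<open>Normalization is impossible here, but both sides lie between 0 and
      \<open>c\<close>.\<close>
    case True
    then show ?thesis
      using *[OF assms(1) P] *[OF assms(2) Q] cQ by (simp add: c_def)
  next
    case False
    with \<open>0 \<le> c\<close> have "0 < c" by simp
    define \<nu> where "\<nu> M = distr (density M (\<lambda>x. ennreal (h x / c))) borel (\<lambda>x. v \<bullet> x)" for M :: "'a measure"
    have integral_\<nu>: "(\<integral>r. f r \<partial>\<nu> M) = (\<integral>x. (h x / c) *\<^sub>R f (v \<bullet> x) \<partial>M)"
      if M: "finite_measure M" "sets M = sets borel" and f [measurable]: "f \<in> borel_measurable borel"
      for M and f :: "real \<Rightarrow> 'b::{banach, second_countable_topology}"
    proof -
      note [measurable] = meas[OF M]
      have "(\<integral>r. f r \<partial>\<nu> M) = (\<integral>x. f (v \<bullet> x) \<partial>density M (\<lambda>x. ennreal (h x / c)))"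
        unfolding \<nu>_def by (rule integral_distr) auto
      also have "\<dots> = (\<integral>x. (h x / c) *\<^sub>R f (v \<bullet> x) \<partial>M)"
        by (rule integral_density) (use nonneg \<open>0 < c\<close> in auto)
      finally show ?thesis .
    qed
    have real_distribution: "real_distribution (\<nu> M)"
      if M: "finite_measure M" "sets M = sets borel" and c: "(\<integral>x. h x \<partial>M) = c" for M
    proof -
      note [measurable] = meas[OF M]
      have "emeasure (density M (\<lambda>x. ennreal (h x / c))) (space M) = (\<integral>\<^sup>+x. ennreal (h x / c) \<partial>M)"
        by (subst emeasure_density) (auto intro!: nn_integral_cong)
      also have "\<dots> = ennreal (\<integral>x. h x / c \<partial>M)"
        using int[OF M] nonneg \<open>0 < c\<close> by (intro nn_integral_eq_integral) auto
      also have "\<dots> = 1" using c \<open>0 < c\<close> by simp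
      finally have "prob_space (density M (\<lambda>x. ennreal (h x / c)))"
        by (intro prob_spaceI) simp
      then have "prob_space (\<nu> M)"
        unfolding \<nu>_def by (rule prob_space.prob_space_distr) simp
      then show ?thesis
        by (simp add: real_distribution_def real_distribution_axioms_def \<nu>_def)
    qed
    have "char (\<nu> P) = char (\<nu> Q)"
    proof
      fix t
      have char_eq: "char (\<nu> M) t = (1 / c) *\<^sub>R (\<integral>x. h x *\<^sub>R iexp ((t *\<^sub>R v) \<bullet> x) \<partial>M)"
        if M: "finite_measure M" "sets M = sets borel" for M
      proof -
        have "char (\<nu> M) t = (\<integral>x. (h x / c) *\<^sub>R iexp (t * (v \<bullet> x)) \<partial>M)"
          unfolding char_def by (rule integral_\<nu>[OF M]) measurable
        also have "\<dots> = (\<integral>x. (1 / c) *\<^sub>R (h x *\<^sub>R iexp ((t *\<^sub>R v) \<bullet> x)) \<partial>M)"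
          by simp
        also have "\<dots> = (1 / c) *\<^sub>R (\<integral>x. h x *\<^sub>R iexp ((t *\<^sub>R v) \<bullet> x) \<partial>M)"
          by (rule integral_scaleR_right)
        finally show ?thesis .
      qed
      show "char (\<nu> P) t = char (\<nu> Q) t"
        unfolding char_eq[OF assms(1) P] char_eq[OF assms(2) Q] eq ..
    qed
    then have "\<nu> P = \<nu> Q"
      using assms(1,2) P Q cQ by (intro Levy_uniqueness real_distribution) (auto simp: c_def)
    moreover have "(\<integral>r. indicator {..b} r \<partial>\<nu> M) = (\<integral>x. h x * indicator S x \<partial>M) / c"
      if M: "finite_measure M" "sets M = sets borel" for M
    proof -
      have "(\<integral>r. indicator {..b} r \<partial>\<nu> M) = (\<integral>x. (h x / c) *\<^sub>R (indicator {..b} (v \<bullet> x) :: real) \<partial>M)"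
        by (rule integral_\<nu>[OF M]) measurable
      also have "\<dots> = (\<integral>x. (h x * indicator S x) / c \<partial>M)"
        by (intro Bochner_Integration.integral_cong) (auto simp: S_def indicator_def)
      finally show ?thesis by simp
    qed
    ultimately show ?thesis
      using assms(1,2) P Q \<open>0 < c\<close> by (metis divide_cancel_right less_irrefl)
  qed
  then show ?thesis by (simp add: S_def)
qed

text \<open>Modulation shifts frequencies: with \<open>w \<bullet> x\<close> for \<open>a\<close>,
  the transform of the reweighted measure combines old transforms at three frequencies, so equality
  for all frequencies is inherited.\<close>

lemma cos_scaleR_iexp:
  "(1 + cos (a + \<theta>)) *\<^sub>R iexp s
    = iexp s + (iexp \<theta> / 2) * iexp (s + a) + (iexp (- \<theta>) / 2) * iexp (s - a)"
proof -
  have "complex_of_real (cos (a + \<theta>)) = (iexp (a + \<theta>) + iexp (- (a + \<theta>))) / 2"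
    by (simp add: cos_of_real[symmetric] cos_exp_eq algebra_simps del: cos_of_real)
  then show ?thesis
    by (simp add: scaleR_conv_of_real algebra_simps add_divide_distrib exp_add[symmetric])
qed

text \<open>
  Multiplying the weight by \<open>1 + cos (w \<bullet> x + \<theta>) \<ge> 0\<close> keeps the hypothesis, so the
  one-dimensional theorem applies to the new weight; the angles \<open>\<theta> = 0, \<pi>, - \<pi> / 2\<close>
  recover the Fourier transform of the restriction to a half-space.
\<close>

lemma fourier_eq_imp_fourier_half_space_eq:
  fixes P Q :: "'a::real_inner measure" and g :: "'a \<Rightarrow> real"
  assumes fin: "finite_measure P" "finite_measure Q"
    and P: "sets P = sets borel" and Q: "sets Q = sets borel"
    and g: "g \<in> borel_measurable borel" and nonneg: "\<And>x. 0 \<le> g x" and bound: "\<And>x. g x \<le> C"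
    and eq: "\<And>w. (\<integral>x. g x *\<^sub>R iexp (w \<bullet> x) \<partial>P) = (\<integral>x. g x *\<^sub>R iexp (w \<bullet> x) \<partial>Q)"
  shows "(\<integral>x. (g x * indicator {x. v \<bullet> x \<le> b} x) *\<^sub>R iexp (w \<bullet> x) \<partial>P)
    = (\<integral>x. (g x * indicator {x. v \<bullet> x \<le> b} x) *\<^sub>R iexp (w \<bullet> x) \<partial>Q)"
proof -
  define f where "f x = g x * indicator {x. v \<bullet> x \<le> b} x" for x
  have "closed {x. v \<bullet> x \<le> b}" by (intro closed_Collect_le continuous_intros)
  then have [measurable]: "{x. v \<bullet> x \<le> b} \<in> sets borel" by simp
  have f: "f \<in> borel_measurable borel" unfolding f_def using g by measurable
  have f_abs: "\<bar>f x\<bar> \<le> C" for x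
    using nonneg[of x] bound[of x] by (auto simp: f_def indicator_def)
  have trig_borel: "(\<lambda>x. cos (w \<bullet> x + \<theta>)) \<in> borel_measurable borel" for \<theta>
    by (intro borel_measurable_continuous_onI continuous_intros)
  have conv: "u \<in> borel_measurable M" if "u \<in> borel_measurable borel" "sets M = sets borel"
    for u :: "'a \<Rightarrow> real" and M
    using that(1) measurable_cong_sets[OF that(2) refl] by blast
  have h_eq: "(\<integral>x. f x * (1 + cos (w \<bullet> x + \<theta>)) \<partial>P) = (\<integral>x. f x * (1 + cos (w \<bullet> x + \<theta>)) \<partial>Q)" for \<theta>
  proof -
    define h where "h x = g x * (1 + cos (w \<bullet> x + \<theta>))" for x
    have cos: "0 \<le> 1 + cos a" "1 + cos a \<le> 2" for a :: real
      using cos_ge_minus_one[of a] cos_le_one[of a] by linarith+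
    have h: "h \<in> borel_measurable borel" unfolding h_def using g trig_borel by measurable
    have h0: "0 \<le> h x" for x unfolding h_def using nonneg cos by simp
    have hC: "h x \<le> C * 2" for x
      unfolding h_def using nonneg bound cos order_trans[OF nonneg bound] by (intro mult_mono) auto
    have "(\<integral>x. h x *\<^sub>R iexp (s \<bullet> x) \<partial>P) = (\<integral>x. h x *\<^sub>R iexp (s \<bullet> x) \<partial>Q)" for s
    proof -
      have "(\<integral>x. h x *\<^sub>R iexp (s \<bullet> x) \<partial>M)
          = (\<integral>x. g x *\<^sub>R iexp (s \<bullet> x) \<partial>M)
            + (iexp \<theta> / 2) * (\<integral>x. g x *\<^sub>R iexp ((s + w) \<bullet> x) \<partial>M)
            + (iexp (- \<theta>) / 2) * (\<integral>x. g x *\<^sub>R iexp ((s - w) \<bullet> x) \<partial>M)"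
        if M: "finite_measure M" "sets M = sets borel" for M
      proof -
        have int: "integrable M (\<lambda>x. g x *\<^sub>R iexp (s \<bullet> x))" for s
          by (rule integrable_scaleR_iexp[OF M conv[OF g M(2)], where C = C])
             (use nonneg bound in \<open>simp add: abs_le_iff\<close>)
        have "h x *\<^sub>R iexp (s \<bullet> x) = g x *\<^sub>R iexp (s \<bullet> x)
            + (iexp \<theta> / 2) * (g x *\<^sub>R iexp ((s + w) \<bullet> x))
            + (iexp (- \<theta>) / 2) * (g x *\<^sub>R iexp ((s - w) \<bullet> x))" for x
          unfolding h_def scaleR_scaleR[symmetric] cos_scaleR_iexp
          by (simp add: inner_add_left inner_diff_left scaleR_right_distrib)
        moreover have "(\<integral>x. u x + p * u' x + q * u'' x \<partial>M)
            = (\<integral>x. u x \<partial>M) + p * (\<integral>x. u' x \<partial>M) + q * (\<integral>x. u'' x \<partial>M)"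
          if "integrable M u" "integrable M u'" "integrable M u''"
          for u u' u'' :: "'a \<Rightarrow> complex" and p q
          using that by simp
        ultimately show ?thesis using int by presburger
      qed
      then show ?thesis using eq fin P Q by simp
    qed
    from Levy_uniqueness_weighted[OF fin P Q h h0 hC this, of v b]
    show ?thesis by (simp add: h_def f_def mult_ac)
  qed
  have int_f: "integrable M f" "integrable M (\<lambda>x. f x * cos (w \<bullet> x + \<theta>))"
    if M: "finite_measure M" "sets M = sets borel" for M \<theta>
  proof -
    note [measurable] = conv[OF f M(2)] conv[OF trig_borel M(2)]
    show "integrable M f"
      by (rule finite_measure.integrable_const_bound[OF M(1), where B = C]) (use f_abs in auto)
    have "\<bar>f x * cos (w \<bullet> x + \<theta>)\<bar> \<le> C" for x
      using mult_mono[OF f_abs[of x] abs_cos_le_one[of "w \<bullet> x + \<theta>"]] order_trans[OF abs_ge_zero f_abs[of x]]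
      by (simp add: abs_mult)
    then show "integrable M (\<lambda>x. f x * cos (w \<bullet> x + \<theta>))"
      by (intro finite_measure.integrable_const_bound[OF M(1), where B = C]) auto
  qed
  have split: "(\<integral>x. f x * (1 + cos (w \<bullet> x + \<theta>)) \<partial>M) = (\<integral>x. f x \<partial>M) + (\<integral>x. f x * cos (w \<bullet> x + \<theta>) \<partial>M)"
    if M: "finite_measure M" "sets M = sets borel" for M \<theta>
    using int_f[OF M] by (simp add: distrib_left)
  \<comment> \<open>\<open>cos (a + pi) = - cos a\<close>, so adding the cases 0 and
    \<open>pi\<close> leaves twice the integral of \<open>f\<close>.\<close>
  have f_eq: "(\<integral>x. f x \<partial>P) = (\<integral>x. f x \<partial>Q)"
    using h_eq[of 0] h_eq[of pi] split[OF fin(1) P, of 0] split[OF fin(1) P, of pi]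
      split[OF fin(2) Q, of 0] split[OF fin(2) Q, of pi] by simp
  have cos_eq: "(\<integral>x. f x * cos (w \<bullet> x + \<theta>) \<partial>P) = (\<integral>x. f x * cos (w \<bullet> x + \<theta>) \<partial>Q)" for \<theta>
    using h_eq[of \<theta>] split[OF fin(1) P, of \<theta>] split[OF fin(2) Q, of \<theta>] f_eq by simp
  have int: "integrable M (\<lambda>x. f x *\<^sub>R iexp (w \<bullet> x))"
    if M: "finite_measure M" "sets M = sets borel" for M
    by (rule integrable_scaleR_iexp[OF M conv[OF f M(2)] f_abs])
  \<comment> \<open>\<open>sin a = cos (a - pi / 2)\<close>, so the cosine integrals give both parts
    of the complex integral.\<close>
  have re: "Re (\<integral>x. f x *\<^sub>R iexp (w \<bullet> x) \<partial>M) = (\<integral>x. f x * cos (w \<bullet> x + 0) \<partial>M)"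
    and im: "Im (\<integral>x. f x *\<^sub>R iexp (w \<bullet> x) \<partial>M) = (\<integral>x. f x * cos (w \<bullet> x + (- pi / 2)) \<partial>M)"
    if M: "finite_measure M" "sets M = sets borel" for M
    using integral_Re[OF int[OF M]] integral_Im[OF int[OF M]]
    by (simp_all add: Re_exp Im_exp cos_diff)
  have "(\<integral>x. f x *\<^sub>R iexp (w \<bullet> x) \<partial>P) = (\<integral>x. f x *\<^sub>R iexp (w \<bullet> x) \<partial>Q)"
    by (rule complex_eqI) (simp_all only: re[OF fin(1) P] re[OF fin(2) Q] im[OF fin(1) P] im[OF fin(2) Q] cos_eq)
  then show ?thesis by (simp add: f_def)
qed

section \<open>Half-spaces and the Borel sigma-algebra\<close>

definition half_space_inter :: "('a::real_inner \<times> real) set \<Rightarrow> 'a set" where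
  "half_space_inter F = {x. \<forall>(v, b)\<in>F. v \<bullet> x \<le> b}"

lemma half_space_inter_borel: "half_space_inter F \<in> sets borel"
proof -
  have "half_space_inter F = (\<Inter>(v, b)\<in>F. {x. v \<bullet> x \<le> b})" by (auto simp: half_space_inter_def)
  moreover have "closed \<dots>"
    by (intro closed_INT) (auto intro!: closed_Collect_le continuous_intros)
  ultimately show ?thesis by simp
qed

text \<open>Each added half-space consumes equality of the transforms at all frequencies and must
  return it in the same generality; hence \<open>w\<close> is arbitrary in the induction.\<close>

lemma fourier_eq_imp_fourier_half_space_inter_eq:
  fixes P Q :: "'a::real_inner measure"
  assumes fin: "finite_measure P" "finite_measure Q"
    and P: "sets P = sets borel" and Q: "sets Q = sets borel"
    and eq: "\<And>w. fourier P w = fourier Q w" and "finite F"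
  shows "(\<integral>x. indicator (half_space_inter F) x *\<^sub>R iexp (w \<bullet> x) \<partial>P)
    = (\<integral>x. indicator (half_space_inter F) x *\<^sub>R iexp (w \<bullet> x) \<partial>Q)"
  using \<open>finite F\<close>
proof (induction F arbitrary: w)
  case empty
  then show ?case using eq[of w] by (simp add: half_space_inter_def fourier_def)
next
  case (insert p F)
  obtain v b where p: "p = (v, b)" by (cases p)
  have "indicator (half_space_inter (insert p F)) x
      = (indicator (half_space_inter F) x * indicator {x. v \<bullet> x \<le> b} x :: real)" for x
    by (auto simp: half_space_inter_def indicator_def p)
  moreover note half_space_inter_borel[of F, measurable]
  ultimately show ?case
    using fourier_eq_imp_fourier_half_space_eq[OF fin P Q _ _ _ insert.IH, where C = 1]
    by simp
qed

text \<open>The norm is the supremum of inner products with unit vectors, and the directions of a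
  dense sequence suffice. This presents a closed ball as a countable intersection of half-spaces. A
  term with \<open>d i = 0\<close> only says \<open>0 \<le> r\<close>.\<close>

lemma norm_le_iff_dense:
  fixes y :: "'a::real_inner"
  assumes dense: "\<And>x e. 0 < e \<Longrightarrow> \<exists>i. dist (x::'a) (d i) < e" and "0 \<le> r"
  shows "norm y \<le> r \<longleftrightarrow> (\<forall>i::nat. sgn (d i) \<bullet> y \<le> r)"
proof
  assume le: "norm y \<le> r"
  have "sgn (d i) \<bullet> y \<le> r" for i
  proof -
    have "sgn (d i) \<bullet> y \<le> norm (sgn (d i)) * norm y" by (rule norm_cauchy_schwarz)
    also have "\<dots> \<le> 1 * r" using le by (intro mult_mono) (auto simp: norm_sgn)
    finally show ?thesis by simp
  qed
  then show "\<forall>i. sgn (d i) \<bullet> y \<le> r" ..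
next
  assume all: "\<forall>i. sgn (d i) \<bullet> y \<le> r"
  show "norm y \<le> r"
  proof (rule ccontr)
    assume "\<not> norm y \<le> r"
    then have "r * norm y < norm y * norm y" using \<open>0 \<le> r\<close> by (intro mult_strict_right_mono) auto
    then have y: "r * norm y < y \<bullet> y" by (simp add: dot_square_norm power2_eq_square)
    \<comment> \<open>The inequality \<open>r < sgn z \<bullet> y\<close> multiplied by
      \<open>norm z\<close>: both sides are now continuous everywhere, so a point of the dense
      sequence near \<open>y\<close> satisfies it too.\<close>
    have "open {z. r * norm z < z \<bullet> y}" by (intro open_Collect_less continuous_intros)
    then obtain e where "0 < e" "ball y e \<subseteq> {z. r * norm z < z \<bullet> y}"
      using y by (metis (no_types, lifting) mem_Collect_eq open_contains_ball)
    moreover obtain i where "dist y (d i) < e" using dense \<open>0 < e\<close> by blast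
    ultimately have i: "r * norm (d i) < d i \<bullet> y" by (auto simp: subset_eq)
    then have "0 < norm (d i)" by auto
    have "d i \<bullet> y = norm (d i) * (sgn (d i) \<bullet> y)" 
      using \<open>0 < norm (d i)\<close> by (simp add: sgn_div_norm)
    also have "\<dots> \<le> norm (d i) * r" using all by (intro mult_left_mono) auto
    finally show False using i by (simp add: mult.commute)
  qed
qed

text \<open>Closed balls are countable intersections of half-spaces by
  \<open>norm_le_iff_dense\<close>, and open sets are countable unions of closed balls with centres
  \<open>d i\<close> and radii \<open>1 / Suc n\<close>.\<close>

lemma sets_borel_eq_half_space_inter:
  fixes d :: "nat \<Rightarrow> 'a::real_inner"
  assumes dense: "\<And>x e. 0 < e \<Longrightarrow> \<exists>i. dist x (d i) < e"
  shows "sets (borel :: 'a measure) = sigma_sets UNIV (half_space_inter ` {F. finite F})"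
    (is "_ = ?\<Sigma>")
proof
  interpret S: sigma_algebra UNIV ?\<Sigma> by (rule sigma_algebra_sigma_sets) simp
  show "?\<Sigma> \<subseteq> sets borel"
    by (rule sets.sigma_sets_subset[of _ borel, simplified]) (auto intro: half_space_inter_borel)
  have half: "{x. v \<bullet> x \<le> b} \<in> ?\<Sigma>" for v b
  proof (rule sigma_sets.Basic)
    have "{x. v \<bullet> x \<le> b} = half_space_inter {(v, b)}" by (auto simp: half_space_inter_def)
    then show "{x. v \<bullet> x \<le> b} \<in> half_space_inter ` {F. finite F}" by blast
  qed
  have cball: "cball a r \<in> ?\<Sigma>" if "0 \<le> r" for a r
  proof -
    have "x \<in> cball a r \<longleftrightarrow> (\<forall>i. sgn (d i) \<bullet> (x - a) \<le> r)" for x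
      using norm_le_iff_dense[OF dense that, of "x - a"] by (simp add: dist_norm norm_minus_commute)
    then have "cball a r = (\<Inter>i. {x. sgn (d i) \<bullet> x \<le> r + sgn (d i) \<bullet> a})"
      by (auto simp: inner_diff_right algebra_simps)
    also have "\<dots> \<in> ?\<Sigma>" using half by (intro S.countable_INT) auto
    finally show ?thesis .
  qed
  have "U \<in> ?\<Sigma>" if "open U" for U
  proof -
    let ?I = "{(i::nat, n::nat). cball (d i) (1 / Suc n) \<subseteq> U}"
    have "U = (\<Union>(i, n)\<in>?I. cball (d i) (1 / Suc n))"
    proof
      show "U \<subseteq> (\<Union>(i, n)\<in>?I. cball (d i) (1 / Suc n))"
      proof
        fix x assume "x \<in> U"
        then obtain e where e: "0 < e" "ball x e \<subseteq> U" using \<open>open U\<close> open_contains_ball by blast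
        \<comment> \<open>Half of \<open>e\<close>, because points of the small ball are up to two
          of its radii away from \<open>x\<close>.\<close>
        obtain n where n: "1 / Suc n < e / 2" using nat_approx_posE[of "e / 2"] e by auto
        obtain i where i: "dist x (d i) < 1 / Suc n" using dense[of "1 / Suc n" x] by auto
        have "cball (d i) (1 / Suc n) \<subseteq> ball x e"
        proof
          fix z assume "z \<in> cball (d i) (1 / Suc n)"
          then have "dist (d i) z \<le> 1 / Suc n" by simp
          then have "dist x z < e" using dist_triangle[of x z "d i"] i n by linarith
          then show "z \<in> ball x e" by simp
        qed
        then have "(i, n) \<in> ?I" using e by auto
        moreover have "x \<in> cball (d i) (1 / Suc n)" using i by (simp add: dist_commute less_imp_le)
        ultimately show "x \<in> (\<Union>(i, n)\<in>?I. cball (d i) (1 / Suc n))" by blast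
      qed
    qed auto
    also have "\<dots> \<in> ?\<Sigma>"
      by (intro S.countable_UN'') (auto intro!: cball countableI_type)
    finally show ?thesis .
  qed
  then have "sigma_sets UNIV {U. open U} \<subseteq> ?\<Sigma>" by (intro S.sigma_sets_subset) auto
  then show "sets borel \<subseteq> ?\<Sigma>" by (simp add: borel_def)
qed

theorem fourier_eq_imp_measure_eq:
  fixes P Q :: "'a::real_inner measure" and d :: "nat \<Rightarrow> 'a"
  assumes fin: "finite_measure P" "finite_measure Q"
    and P: "sets P = sets borel" and Q: "sets Q = sets borel"
    and dense: "\<And>x e. 0 < e \<Longrightarrow> \<exists>i. dist x (d i) < e"
    and eq: "\<And>w. fourier P w = fourier Q w"
  shows "P = Q"
proof (rule measure_eqI_generator_eq[where E = "half_space_inter ` {F. finite F}" and \<Omega> = UNIV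
      and A = "\<lambda>_. UNIV"])
  interpret P: finite_measure P by fact
  interpret Q: finite_measure Q by fact
  show "Int_stable (half_space_inter ` {F::('a \<times> real) set. finite F})"
  proof (rule Int_stableI_image)
    fix F G :: "('a \<times> real) set" assume "F \<in> {F. finite F}" "G \<in> {F. finite F}"
    then show "\<exists>K\<in>{F. finite F}. half_space_inter F \<inter> half_space_inter G = half_space_inter K"
      by (intro bexI[of _ "F \<union> G"]) (auto simp: half_space_inter_def)
  qed
  fix X assume "X \<in> half_space_inter ` {F::('a \<times> real) set. finite F}"
  then obtain F where F: "finite F" "X = half_space_inter F" by auto
  \<comment> \<open>At frequency 0 the transform of the restriction to \<open>X\<close> is its
    mass.\<close>
  have "complex_of_real (measure P X) = complex_of_real (measure Q X)"
    using fourier_eq_imp_fourier_half_space_inter_eq[OF fin P Q eq F(1), of 0]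
      half_space_inter_borel[of F] P Q sets_eq_imp_space_eq[OF P] sets_eq_imp_space_eq[OF Q]
    by (simp add: scaleR_conv_of_real F(2))
  then show "emeasure P X = emeasure Q X"
    by (simp add: P.emeasure_eq_measure Q.emeasure_eq_measure)
next
  show "range (\<lambda>_::nat. UNIV) \<subseteq> half_space_inter ` {F::('a \<times> real) set. finite F}"
    by (auto simp: half_space_inter_def intro!: image_eqI[of _ _ "{}"])
qed (use sets_borel_eq_half_space_inter[OF dense] P Q finite_measure.emeasure_finite[OF fin(1)] in auto)


section \<open>Translation invariant kernels\<close>

lemma norm_fourier_le:
  assumes "prob_space \<mu>"
  shows "norm (fourier \<mu> w) \<le> 1"
proof -
  interpret prob_space \<mu> by fact
  have "norm (fourier \<mu> w) \<le> (\<integral>v. norm (iexp (w \<bullet> v)) \<partial>\<mu>)"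
    unfolding fourier_def by (rule integral_norm_bound)
  then show ?thesis by (simp add: prob_space)
qed

lemma continuous_on_fourier:
  fixes \<mu> :: "'a::real_inner measure"
  assumes "finite_measure \<mu>" and sets: "sets \<mu> = sets borel"
  shows "continuous_on UNIV (fourier \<mu>)"
proof (intro continuous_at_imp_continuous_on ballI continuous_at_sequentiallyI)
  interpret finite_measure \<mu> by fact
  fix w :: 'a and u assume u: "u \<longlonglongrightarrow> w"
  show "(\<lambda>n. fourier \<mu> (u n)) \<longlonglongrightarrow> fourier \<mu> w"
    unfolding fourier_def
  proof (rule integral_dominated_convergence[where w = "\<lambda>_. 1"])
    show "(\<lambda>v. iexp (x \<bullet> v)) \<in> borel_measurable \<mu>" for x
      by (intro borel_measurable_continuous_sets_eq[OF sets] continuous_intros)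
    then show "(\<lambda>v. iexp (u n \<bullet> v)) \<in> borel_measurable \<mu>" for n .
    have "(\<lambda>n. iexp (u n \<bullet> v)) \<longlonglongrightarrow> iexp (w \<bullet> v)" for v
      using u by (intro tendsto_intros)
    then show "AE v in \<mu>. (\<lambda>n. iexp (u n \<bullet> v)) \<longlonglongrightarrow> iexp (w \<bullet> v)" by simp
  qed auto
qed

text \<open>It is used with a conjugate character for \<open>g\<close>, to express the mean
  embedding through \<open>fourier P\<close>, and with \<open>cnj D\<close>, to integrate the
  resulting identity once more. The functions \<open>e n\<close> supply joint measurability.\<close>

lemma fourier_Fubini:
  fixes P \<mu> :: "'a::real_inner measure" and e :: "nat \<Rightarrow> 'a \<Rightarrow> 'a" and g :: "'a \<Rightarrow> complex"
  assumes fin: "finite_measure P" "finite_measure \<mu>"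
    and P: "sets P = sets borel" and \<mu>: "sets \<mu> = sets borel"
    and e: "\<And>n. simple_function borel (e n)" "\<And>x. (\<lambda>n. e n x) \<longlonglongrightarrow> x"
    and g: "continuous_on UNIV g" and bound: "\<And>v. norm (g v) \<le> C"
  shows "(\<integral>x. (\<integral>v. g v * iexp (x \<bullet> v) \<partial>\<mu>) \<partial>P) = (\<integral>v. g v * fourier P v \<partial>\<mu>)"
proof -
  interpret P: finite_measure P by fact
  interpret \<mu>: finite_measure \<mu> by fact
  interpret pair_sigma_finite P \<mu> ..
  interpret P\<mu>: finite_measure "P \<Otimes>\<^sub>M \<mu>" by (rule finite_measure_pair_measure) fact+
  let ?f = "\<lambda>x v. g v * iexp (x \<bullet> v)"
  have "(\<lambda>(x, v). ?f x v) \<in> borel_measurable (borel \<Otimes>\<^sub>M borel)"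
    by (rule simple_approximation_measurable_pair[OF e]) (intro continuous_intros g)+
  then have [measurable]: "case_prod ?f \<in> borel_measurable (P \<Otimes>\<^sub>M \<mu>)"
    using measurable_cong_sets[OF sets_pair_measure_cong[OF P \<mu>] refl] by blast
  have "integrable (P \<Otimes>\<^sub>M \<mu>) (case_prod ?f)"
    by (rule P\<mu>.integrable_const_bound[where B = C]) (auto simp: norm_mult bound)
  then have "(\<integral>x. (\<integral>v. ?f x v \<partial>\<mu>) \<partial>P) = (\<integral>v. (\<integral>x. ?f x v \<partial>P) \<partial>\<mu>)"
    by (rule Fubini_integral[symmetric])
  also have "\<dots> = (\<integral>v. g v * fourier P v \<partial>\<mu>)"
    by (simp add: fourier_def inner_commute)
  finally show ?thesis .
qed

text \<open>The set where a continuous function is nonzero is open, and an open null set is empty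
  under full support.\<close>

lemma full_support_AE_eq_0:
  fixes f :: "'a::topological_space \<Rightarrow> 'b::{real_normed_vector}"
  assumes sets: "sets \<mu> = sets borel" and full: "full_support \<mu>"
    and f: "continuous_on UNIV f" and ae: "AE v in \<mu>. f v = 0"
  shows "f v = 0"
proof (rule ccontr)
  assume "f v \<noteq> 0"
  have "open {v. f v \<noteq> 0}"
    by (intro open_Collect_neq f continuous_intros)
  moreover have "emeasure \<mu> {v. f v \<noteq> 0} = 0"
    using ae \<open>open _\<close> sets sets_eq_imp_space_eq[OF sets] by (subst AE_iff_measurable[symmetric]) auto
  ultimately show False
    using full \<open>f v \<noteq> 0\<close> by (auto simp: full_support_def)
qed

text \<open>The two integrations against \<open>P - Q\<close> are carried out one at a time and
  separately for \<open>P\<close> and \<open>Q\<close>, so only positive measures occur. The first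
  shows that \<open>D\<close> integrates to 0 against every character; the second averages these
  characters into \<open>fourier P\<close> and \<open>fourier Q\<close>, whose difference is
  \<open>D\<close>.\<close>

lemma fourier_eq_of_mean_eq:
  fixes P Q \<mu> :: "'a::real_inner measure" and e :: "nat \<Rightarrow> 'a \<Rightarrow> 'a"
  assumes P: "borel_prob P" and Q: "borel_prob Q" and \<mu>: "borel_prob \<mu>" "full_support \<mu>"
    and e: "\<And>n. simple_function borel (e n)" "\<And>x. (\<lambda>n. e n x) \<longlonglongrightarrow> x"
    and eq: "\<And>x. (\<integral>y. fourier \<mu> (y - x) \<partial>P) = (\<integral>y. fourier \<mu> (y - x) \<partial>Q)"
  shows "fourier P w = fourier Q w"
proof -
  have prob: "prob_space P" "prob_space Q" "prob_space \<mu>"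
    and sets: "sets P = sets borel" "sets Q = sets borel" "sets \<mu> = sets borel"
    using P Q \<mu> by (auto simp: borel_prob_def)
  then have fin: "finite_measure P" "finite_measure Q" "finite_measure \<mu>"
    by (auto simp: prob_space_def)
  interpret \<mu>: prob_space \<mu> by fact
  define D where "D v = fourier P v - fourier Q v" for v
  have cont: "continuous_on UNIV (fourier P)" "continuous_on UNIV (fourier Q)"
    using continuous_on_fourier fin sets by blast+
  then have D: "continuous_on UNIV D" unfolding D_def by (intro continuous_intros)
  have D_bound: "norm (D v) \<le> 2" for v
    unfolding D_def using norm_triangle_ineq4[of "fourier P v" "fourier Q v"]
      norm_fourier_le[OF prob(1), of v] norm_fourier_le[OF prob(2), of v] by linarith
  have integrable: "integrable \<mu> f" if "continuous_on UNIV f" "\<And>v. norm (f v) \<le> C"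
    for f :: "'a \<Rightarrow> complex" and C
    using borel_measurable_continuous_sets_eq[OF sets(3) that(1)] that(2)
    by (intro \<mu>.integrable_const_bound[where B = C]) auto
  have "(\<integral>v. iexp (- (x \<bullet> v)) * D v \<partial>\<mu>) = 0" for x
  proof -
    have 1: "(\<integral>y. fourier \<mu> (y - x) \<partial>M) = (\<integral>v. iexp (- (x \<bullet> v)) * fourier M v \<partial>\<mu>)"
      if M: "finite_measure M" "sets M = sets borel" for M
    proof -
      have "fourier \<mu> (y - x) = (\<integral>v. iexp (- (x \<bullet> v)) * iexp (y \<bullet> v) \<partial>\<mu>)" for y
        unfolding fourier_def exp_add[symmetric]
        by (intro Bochner_Integration.integral_cong) (auto simp: inner_diff_left algebra_simps)
      then show ?thesis
        using fourier_Fubini[OF M(1) fin(3) M(2) sets(3) e, of "\<lambda>v. iexp (- (x \<bullet> v))" 1]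
        by (simp add: continuous_intros)
    qed
    have "integrable \<mu> (\<lambda>v. iexp (- (x \<bullet> v)) * fourier M v)"
      if "prob_space M" "continuous_on UNIV (fourier M)" for M
      by (intro integrable[of _ 1] continuous_intros that)
         (use norm_fourier_le[OF that(1)] in \<open>simp add: norm_mult\<close>)
    then show ?thesis
      using 1[OF fin(1) sets(1)] 1[OF fin(2) sets(2)] eq[of x] prob cont
      by (simp add: D_def right_diff_distrib)
  qed
  \<comment> \<open>Conjugation turns the frequency \<open>- x\<close> into \<open>x\<close>, the
    form over which \<open>fourier_Fubini\<close> integrates, and moves the conjugate onto
    \<open>D\<close>, preparing \<open>cnj (D v) * D v\<close>.\<close>
  moreover have "cnj (iexp (- (x \<bullet> v)) * D v) = cnj (D v) * iexp (x \<bullet> v)" for x v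
    by (simp add: exp_cnj mult.commute)
  ultimately have zero: "(\<integral>v. cnj (D v) * iexp (x \<bullet> v) \<partial>\<mu>) = 0" for x
    using Bochner_Integration.integral_cnj[of \<mu> "\<lambda>v. iexp (- (x \<bullet> v)) * D v"]
    by (simp only: complex_cnj_zero)
  have cnj_D: "(\<integral>v. cnj (D v) * fourier M v \<partial>\<mu>) = 0"
    if M: "finite_measure M" "sets M = sets borel" for M
    using fourier_Fubini[OF M(1) fin(3) M(2) sets(3) e, of "\<lambda>v. cnj (D v)" 2] D_bound zero
    by (simp add: D continuous_intros)
  have "integrable \<mu> (\<lambda>v. cnj (D v) * fourier M v)"
    if "prob_space M" "continuous_on UNIV (fourier M)" for M
  proof (intro integrable[of _ "2 * 1"] continuous_intros that D)
    show "norm (cnj (D v) * fourier M v) \<le> 2 * 1" for v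
      unfolding norm_mult using D_bound[of v] norm_fourier_le[OF that(1), of v]
      by (intro mult_mono) auto
  qed
  then have "(\<integral>v. cnj (D v) * D v \<partial>\<mu>) = 0"
    using cnj_D[OF fin(1) sets(1)] cnj_D[OF fin(2) sets(2)] prob cont
    by (simp add: D_def right_diff_distrib)
  moreover have "cnj (D v) * D v = complex_of_real ((norm (D v))\<^sup>2)" for v
    by (simp add: complex_norm_square mult.commute del: of_real_power)
  ultimately have "(\<integral>v. (norm (D v))\<^sup>2 \<partial>\<mu>) = 0" by (simp del: of_real_power)
  moreover have "integrable \<mu> (\<lambda>v. (norm (D v))\<^sup>2)"
  proof (rule \<mu>.integrable_const_bound[where B = "2\<^sup>2"])
    show "(\<lambda>v. (norm (D v))\<^sup>2) \<in> borel_measurable \<mu>"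
      by (intro borel_measurable_continuous_sets_eq[OF sets(3)] continuous_intros D)
    have "(norm (D v))\<^sup>2 \<le> 2\<^sup>2" for v by (intro power_mono D_bound) simp
    then show "AE v in \<mu>. norm ((norm (D v))\<^sup>2) \<le> 2\<^sup>2" by simp
  qed
  ultimately have "AE v in \<mu>. (norm (D v))\<^sup>2 = 0"
    by (subst (asm) integral_nonneg_eq_0_iff_AE) auto
  then have "AE v in \<mu>. D v = 0" by simp
  then have "D w = 0" by (rule full_support_AE_eq_0[OF sets(3) \<mu>(2) D])
  then show ?thesis by (simp add: D_def)
qed

theorem theorem10:
  fixes \<mu> :: "'a::{real_inner, complete_space} measure"
    and k :: "'a \<Rightarrow> 'a \<Rightarrow> real"
  assumes "borel_prob \<mu>"
    and "is_kernel k"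
    and "\<And>x y. complex_of_real (k x y) = fourier \<mu> (x - y)"
    and "full_support \<mu>"
  shows "characteristic k"
proof -
  have \<mu>: "prob_space \<mu>" "finite_measure \<mu>" "sets \<mu> = sets borel"
    using assms(1) by (auto simp: borel_prob_def prob_space_def)
  obtain d :: "nat \<Rightarrow> 'a" where dense: "\<And>x e. 0 < e \<Longrightarrow> \<exists>i. dist x (d i) < e"
    using full_support_imp_dense_sequence[OF \<mu>(2,3) assms(4)] by blast
  obtain e :: "nat \<Rightarrow> 'a \<Rightarrow> 'a"
    where e: "\<And>n. simple_function borel (e n)" "\<And>x. (\<lambda>n. e n x) \<longlonglongrightarrow> x"
    using dense_sequence_imp_simple_approximation[of d, OF dense] by blast
  have k: "k x y = Re (fourier \<mu> (x - y))" for x y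
    using arg_cong[OF assms(3)[of x y], of Re] by simp
  have fourier: "continuous_on UNIV (fourier \<mu>)" using \<mu> by (intro continuous_on_fourier)
  interpret kernel k by standard fact
  \<comment> \<open>The bound is 1 because every diagonal value is the real part of
    \<open>fourier \<mu> 0\<close>.\<close>
  interpret continuous_kernel_space k "rkhs_carrier k" "rkhs_inner k" 1
  proof
    show "is_rkhs k (rkhs_carrier k) (rkhs_inner k)" by (rule is_rkhs_rkhs)
    show "k y y \<le> 1" for y
      using complex_Re_le_cmod[of "fourier \<mu> 0"] norm_fourier_le[OF \<mu>(1), of 0] by (simp add: k)
    show "continuous_on UNIV (\<lambda>y. k y y)" by (simp add: k)
    show "continuous_on UNIV (k y)" for y
      unfolding k by (intro continuous_intros continuous_on_compose2[OF fourier]) auto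
  qed
  show ?thesis
    unfolding characteristic_def
  proof (intro allI impI, elim conjE)
    fix P Q :: "'a measure"
    assume P: "borel_prob P" and Q: "borel_prob Q" and MMD: "MMD k P Q = 0"
    have emb: "mean_embedding k M = (\<lambda>x. \<integral>y. k x y \<partial>M)" "mean_embedding k M \<in> rkhs_carrier k"
      if "borel_prob M" for M
      using bochner_integral_on_feature[OF _ _ e, of M] that
      by (auto simp: mean_embedding_def borel_prob_def prob_space_def)
    \<comment> \<open>Membership of both embeddings in the RKHS is essential: outside it
      \<open>ip\<close> is 0 by convention, and norm 0 would say nothing.\<close>
    have "(\<lambda>x. mean_embedding k P x - mean_embedding k Q x) = (\<lambda>x. 0)"
      using MMD unfolding MMD_def
      by (intro ip_norm_eq_0 diff_mem emb P Q)
    then have "(\<integral>y. k x y \<partial>P) = (\<integral>y. k x y \<partial>Q)" for x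
      by (simp add: emb P Q fun_eq_iff)
    \<comment> \<open>Symmetry of \<open>k\<close> exchanges \<open>x - y\<close> for
      \<open>y - x\<close>, so that the integration variable enters with a positive sign.\<close>
    moreover have "(\<integral>y. fourier \<mu> (y - x) \<partial>M) = complex_of_real (\<integral>y. k x y \<partial>M)" for x M
      by (simp add: assms(3)[symmetric] kernel_commute[of x])
    ultimately have "(\<integral>y. fourier \<mu> (y - x) \<partial>P) = (\<integral>y. fourier \<mu> (y - x) \<partial>Q)" for x
      by simp
    then have "fourier P w = fourier Q w" for w
      by (rule fourier_eq_of_mean_eq[OF P Q assms(1,4) e])
    then show "P = Q"
      using P Q dense by (intro fourier_eq_imp_measure_eq) (auto simp: borel_prob_def prob_space_def)
  qed
qed

end
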